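(* Let $\nu\in\mathbb{C}$ and $x\in[0,1]$. Then the following Fourier–Legendre expansion holds: \[ {}_{2}F_{1}\left(-\nu,\nu+1;1;x\right)\,{}_{2}F_{1}\left(-\nu,\nu+1;1;1-x\right) =-\frac{\sin\left(\pi\nu\right)}{2}\sum_{m\geq0}\left[\frac{1}{4^{m}}\binom{2m}{m}\right]^{2}\frac{\Gamma\left(m-\nu\right)\Gamma\left(m+\nu+1\right)\left(4m+1\right)}{\Gamma\left(m-\nu+\frac{1}{2}\right)\Gamma\left(m+\nu+\frac{3}{2}\right)}P_{2m}\left(2x-1\right), \] where any indeterminate form appearing in the coefficients is to be interpreted as the corresponding limit.
   Context: ${}_{2}F_{1}(a,b;c;z)$ denotes the Gauss hypergeometric function, $\Gamma$ is Euler's Gamma function, and $P_{n}$ denotes the Legendre polynomial of degree $n$. A Fourier–Legendre expansion of a function $f$ on $[0,1]$ is its expansion as a series $\sum_{n\ge0} c_n P_n(2x-1)$ with $c_n=(2n+1)\int_0^1 f(x)P_n(2x-1)\,dx$.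
   Formalization: At x = 0 or 1 with ν not an integer, both the hypergeometric series at 1 and the right-hand series diverge, so there the equality is replaced by the statement that the partial sums of both sides tend to infinity; equality is proved for 0<x<1, and on all of [0,1] for integer ν. *)

theory Defs
  imports "HOL-Analysis.Analysis" "HOL-Analysis.FPS_Convergence"
    "HOL-Computational_Algebra.Computational_Algebra"
begin

definition hyp2F1_fps :: "complex \<Rightarrow> complex \<Rightarrow> complex \<Rightarrow> complex fps" where
  "hyp2F1_fps a b c = fps_hypergeo [a, b] [c] 1"

(* The sum of the Gauss series itself, not its analytic continuation; it is a meaningful value
   for norm z < 1, and also at z = 1 if the series terminates. *)
definition hyp2F1 :: "complex \<Rightarrow> complex \<Rightarrow> complex \<Rightarrow> complex \<Rightarrow> complex" where
  "hyp2F1 a b c z = eval_fps (hyp2F1_fps a b c) z"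

definition hyp2F1_partial :: "complex \<Rightarrow> complex \<Rightarrow> complex \<Rightarrow> nat \<Rightarrow> complex \<Rightarrow> complex" where
  "hyp2F1_partial a b c N z = (\<Sum>k<N. fps_nth (hyp2F1_fps a b c) k * z ^ k)"

(* Rodrigues' formula *)
definition legendre_poly :: "nat \<Rightarrow> real poly" where
  "legendre_poly n = smult (1 / (2 ^ n * fact n)) ((pderiv ^^ n) ([:-1, 0, 1:] ^ n))"

definition legendre_P :: "nat \<Rightarrow> real \<Rightarrow> real" where
  "legendre_P n t = poly (legendre_poly n) t"

definition fourier_legendre_coeff :: "(real \<Rightarrow> complex) \<Rightarrow> nat \<Rightarrow> complex" where
  "fourier_legendre_coeff f n =
     of_nat (2 * n + 1) * integral {0..1} (\<lambda>t. f t * of_real (legendre_P n (2 * t - 1)))"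

(* At a pole of a Gamma factor in the denominator the library value Gamma z = 0 together with
   division by zero yields 0, which is the value of the entire function 1 / Gamma there. *)
definition expansion_coeff_formula :: "complex \<Rightarrow> nat \<Rightarrow> complex" where
  "expansion_coeff_formula \<nu> m =
     - (sin (of_real pi * \<nu>) / 2) *
     ((1 / 4 ^ m * of_nat ((2 * m) choose m))\<^sup>2 *
      (Gamma (of_nat m - \<nu>) * Gamma (of_nat m + \<nu> + 1) * of_nat (4 * m + 1) /
       (Gamma (of_nat m - \<nu> + 1 / 2) * Gamma (of_nat m + \<nu> + 3 / 2))))"

(* The indeterminate coefficients are those with a Gamma pole in the numerator: \<nu> is then an
   integer, so that sin (pi * \<nu>) = 0. *)
definition expansion_coeff :: "complex \<Rightarrow> nat \<Rightarrow> complex" where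
  "expansion_coeff \<nu> m =
     (if of_nat m - \<nu> \<in> \<int>\<^sub>\<le>\<^sub>0 \<or> of_nat m + \<nu> + 1 \<in> \<int>\<^sub>\<le>\<^sub>0
      then Lim (at \<nu>) (\<lambda>\<mu>. expansion_coeff_formula \<mu> m)
      else expansion_coeff_formula \<nu> m)"

definition hyp2F1_product :: "complex \<Rightarrow> real \<Rightarrow> complex" where
  "hyp2F1_product \<nu> x =
     hyp2F1 (- \<nu>) (\<nu> + 1) 1 (of_real x) * hyp2F1 (- \<nu>) (\<nu> + 1) 1 (of_real (1 - x))"

end

theory Submission
  imports Defs
begin

text \<open>
Write \<open>F\<^sub>\<nu>\<close> for the hypergeometric function, \<open>w(x) = F\<^sub>\<nu>(x) F\<^sub>\<nu>(1 - x)\<close> and \<open>I\<^sub>n\<close> for the integral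
of \<open>w(x) P\<^sub>n(2 x - 1)\<close> over the unit interval. Both factors of \<open>w\<close> solve Legendre's equation with
eigenvalue \<open>\<nu> (\<nu> + 1)\<close>, so \<open>w\<close> solves its symmetric square, a third-order equation; integrating
that equation against \<open>P\<^sub>n\<close> gives a two-term recurrence between \<open>I\<^sub>n\<close> and \<open>I\<^sub>n\<^sub>+\<^sub>2\<close>. By Green's
identity, \<open>F\<^sub>\<mu>(x) F\<^sub>\<nu>(1 - x)\<close> has integral
\<open>(sin (\<pi> \<nu>) - sin (\<pi> \<mu>)) / (\<pi> (\<nu> - \<mu>) (\<nu> + \<mu> + 1))\<close>, and \<open>\<mu> \<rightarrow> \<nu>\<close> gives
\<open>I\<^sub>0 = cos (\<pi> \<nu>) / (2 \<nu> + 1)\<close>. This settles all \<open>\<nu>\<close> with \<open>2 \<nu>\<close> not an integer, and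
continuity of \<open>I\<^sub>n\<close> in \<open>\<nu>\<close> the others.

The \<open>m\<close>-th coefficient is asymptotic to \<open>- 2 sin (\<pi> \<nu>) / (\<pi> m)\<close>, which gives the divergence at the
endpoints, where \<open>P\<^sub>2\<^sub>m = 1\<close>. Inside the interval,
\<open>P\<^sub>2\<^sub>m(t) = O(m\<^sup>-\<^sup>1\<^sup>/\<^sup>2 (1 - t\<^sup>2)\<^sup>-\<^sup>1\<^sup>/\<^sup>2)\<close>, so the series converges
absolutely and locally uniformly to a continuous function which has the same Legendre coefficients as
\<open>w\<close>, hence equals \<open>w\<close> by the Weierstrass approximation theorem.
\<close>

section \<open>Legendre polynomials\<close>

lemma higher_pderiv_pCons_0:
  fixes p :: "'a::{comm_semiring_1,semiring_no_zero_divisors} poly"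
  shows "(pderiv ^^ n) (pCons 0 p) =
           pCons 0 ((pderiv ^^ n) p) + smult (of_nat n) ((pderiv ^^ (n - 1)) p)"
proof (induction n)
  case (Suc n)
  have "smult (of_nat n) (pderiv ((pderiv ^^ (n - 1)) p)) = smult (of_nat n) ((pderiv ^^ n) p)"
    by (cases n) auto
  then show ?case
    by (simp add: Suc.IH pderiv_add pderiv_pCons pderiv_smult smult_add_left add_ac)
qed simp

lemma pderiv_legendre_kernel_power:
  "pderiv ([:-1, 0, 1:] ^ Suc n) = smult (2 * real (Suc n)) (pCons 0 ([:-1, 0, 1:] ^ n))"
proof -
  have "pderiv [:-1, 0, 1 :: real:] = [:0, 2:]"
    by (simp add: pderiv_pCons)
  then show ?thesis
    unfolding pderiv_power_Suc by (simp add: algebra_simps)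
qed

lemma higher_pderiv_legendre_kernel_power_Suc:
  "(pderiv ^^ Suc n) ([:-1, 0, 1:] ^ Suc m) =
     smult (2 * real (Suc m)) ((pderiv ^^ n) (pCons 0 ([:-1, 0, 1:] ^ m)))"
  unfolding funpow_Suc_right o_apply pderiv_legendre_kernel_power higher_pderiv_smult ..

lemma pderiv_legendre_poly_Suc:
  "pderiv (legendre_poly (Suc n)) =
     pCons 0 (pderiv (legendre_poly n)) + smult (real (Suc n)) (legendre_poly n)"
proof -
  let ?W = "[:-1, 0, 1 :: real:]"
  have "pderiv ((pderiv ^^ Suc n) (?W ^ Suc n)) =
          smult (2 * real (Suc n)) ((pderiv ^^ Suc n) (pCons 0 (?W ^ n)))"
    using higher_pderiv_legendre_kernel_power_Suc[of "Suc n" n] by simp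
  also have "\<dots> = smult (2 * real (Suc n))
      (pCons 0 ((pderiv ^^ Suc n) (?W ^ n)) + smult (real (Suc n)) ((pderiv ^^ n) (?W ^ n)))"
    unfolding higher_pderiv_pCons_0 by simp
  finally have deriv: "pderiv ((pderiv ^^ Suc n) (?W ^ Suc n)) = \<dots>" .
  have "1 / (2 ^ Suc n * fact (Suc n)) * (2 * real (Suc n)) = 1 / (2 ^ n * fact n)"
    by (simp add: divide_simps)
  then show ?thesis
    unfolding legendre_poly_def pderiv_smult deriv smult_smult
    by (simp add: smult_add_right mult.commute)
qed

text \<open>Both expansions of the \<open>(n + 1)\<close>-st derivative of \<open>(t\<^sup>2 - 1)\<^sup>n\<^sup>+\<^sup>1\<close>, as a product and as the
  \<open>n\<close>-th derivative of \<open>2 (n + 1) t (t\<^sup>2 - 1)\<^sup>n\<close>, contain the \<open>(n - 1)\<close>-st derivative of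
  \<open>(t\<^sup>2 - 1)\<^sup>n\<close>; eliminating it gives the recurrence.\<close>

lemma legendre_poly_Suc:
  "smult (real (Suc n)) (legendre_poly (Suc n)) =
     [:-1, 0, 1:] * pderiv (legendre_poly n) + smult (real (Suc n)) (pCons 0 (legendre_poly n))"
proof -
  let ?W = "[:-1, 0, 1 :: real:]"
  define D where "D j = (pderiv ^^ j) (?W ^ n)" for j
  define R where "R = (pderiv ^^ Suc n) (?W ^ Suc n)"
  have pCons_derivs:
    "(pderiv ^^ j) (pCons 0 (?W ^ n)) = pCons 0 (D j) + smult (real j) (D (j - 1))" for j
    unfolding D_def by (rule higher_pderiv_pCons_0)
  have chain: "R = smult (2 * real (Suc n)) (pCons 0 (D n) + smult (real n) (D (n - 1)))"
    unfolding R_def higher_pderiv_legendre_kernel_power_Suc pCons_derivs ..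
  have "?W ^ Suc n = pCons 0 (pCons 0 (?W ^ n)) + smult (-1) (?W ^ n)"
    by simp
  then have product: "R = pCons 0 (pCons 0 (D (Suc n)) + smult (real (Suc n)) (D n))
      + smult (real (Suc n)) (pCons 0 (D n) + smult (real n) (D (n - 1))) + smult (-1) (D (Suc n))"
    unfolding R_def
    by (simp only: higher_pderiv_add higher_pderiv_smult higher_pderiv_pCons_0 pCons_derivs
          diff_Suc_1 D_def)
  have "poly R t = 2 * ((t\<^sup>2 - 1) * poly (D (Suc n)) t + real (Suc n) * (t * poly (D n) t))" for t
    using arg_cong[OF chain, of "\<lambda>p. poly p t"] arg_cong[OF product, of "\<lambda>p. poly p t"]
    by (simp add: algebra_simps power2_eq_square)
  then have R: "R = smult 2 (?W * D (Suc n) + smult (real (Suc n)) (pCons 0 (D n)))"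
    by (simp add: poly_eq_poly_eq_iff[symmetric] fun_eq_iff algebra_simps power2_eq_square)
  have "smult (real (Suc n)) (legendre_poly (Suc n)) =
          smult (real (Suc n) / (2 ^ Suc n * fact (Suc n)) * 2)
            (?W * D (Suc n) + smult (real (Suc n)) (pCons 0 (D n)))"
    unfolding legendre_poly_def R_def[symmetric] R by simp
  also have "real (Suc n) / (2 ^ Suc n * fact (Suc n)) * 2 = 1 / (2 ^ n * fact n)"
    by (simp add: divide_simps)
  finally show ?thesis
    by (simp add: legendre_poly_def D_def smult_add_right pderiv_smult mult.commute)
qed

lemma degree_legendre_poly: "degree (legendre_poly n) = n"
proof -
  have "degree ([:-1, 0, 1 :: real:] ^ n) = 2 * n"
    by (subst degree_power_eq) auto
  then show ?thesis
    by (simp add: legendre_poly_def degree_higher_pderiv)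
qed

lemma legendre_poly_induct [case_names zero add]:
  assumes zero: "P 0"
    and add: "\<And>p c n. P p \<Longrightarrow> P (p + smult c (legendre_poly n))"
  shows "P p"
proof (induction "if p = 0 then 0 else Suc (degree p)" arbitrary: p rule: less_induct)
  case less
  show ?case
  proof (cases "p = 0")
    case False
    define n where "n = degree p"
    define c where "c = lead_coeff p / coeff (legendre_poly n) n"
    define q where "q = p - smult c (legendre_poly n)"
    have "legendre_poly n \<noteq> 0"
      by (cases "n = 0") (simp add: legendre_poly_def, metis degree_0 degree_legendre_poly)
    then have "coeff (legendre_poly n) n \<noteq> 0"
      by (metis degree_legendre_poly leading_coeff_0_iff)
    then have "coeff q n = 0"
      by (simp add: q_def c_def n_def)
    moreover have "degree q \<le> n"
      unfolding q_def by (rule degree_diff_le) (simp_all add: n_def degree_legendre_poly)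
    ultimately have "q = 0 \<or> degree q < n"
      by (metis le_neq_implies_less leading_coeff_0_iff)
    then have "P q"
      using less False by (auto simp: n_def zero)
    then show ?thesis
      using add[of q c n] by (simp add: q_def)
  qed (simp add: zero)
qed

definition legendre_P' :: "nat \<Rightarrow> real \<Rightarrow> real" where
  "legendre_P' n t = poly (pderiv (legendre_poly n)) t"

lemma legendre_P_has_field_derivative [derivative_intros]:
  assumes "(g has_field_derivative g') (at t within S)"
  shows "((\<lambda>x. legendre_P n (g x)) has_field_derivative legendre_P' n (g t) * g') (at t within S)"
  unfolding legendre_P_def legendre_P'_def
  by (rule DERIV_chain2[OF poly_DERIV assms])

lemma continuous_on_legendre_P [continuous_intros]:
  "continuous_on S g \<Longrightarrow> continuous_on S (\<lambda>x. legendre_P n (g x))"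
  "continuous_on S g \<Longrightarrow> continuous_on S (\<lambda>x. legendre_P' n (g x))"
  unfolding legendre_P_def legendre_P'_def by (intro continuous_intros; simp)+

lemma legendre_P_0 [simp]: "legendre_P 0 t = 1" "legendre_P' 0 t = 0"
  by (simp_all add: legendre_P_def legendre_P'_def legendre_poly_def)

lemma legendre_P'_Suc:
  "legendre_P' (Suc n) t = t * legendre_P' n t + (real n + 1) * legendre_P n t"
  using arg_cong[OF pderiv_legendre_poly_Suc[of n], of "\<lambda>p. poly p t"]
  by (simp add: legendre_P_def legendre_P'_def algebra_simps)

lemma legendre_P_Suc:
  "(real n + 1) * legendre_P (Suc n) t =
     (t\<^sup>2 - 1) * legendre_P' n t + (real n + 1) * t * legendre_P n t"
  using arg_cong[OF legendre_poly_Suc[of n], of "\<lambda>p. poly p t"]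
  by (simp add: legendre_P_def legendre_P'_def algebra_simps power2_eq_square)

lemma one_minus_sq_legendre_P'_Suc:
  "(1 - t\<^sup>2) * legendre_P' (Suc n) t = (real n + 1) * (legendre_P n t - t * legendre_P (Suc n) t)"
  using legendre_P_Suc[of n t] legendre_P'_Suc[of n t] by algebra

lemma legendre_P_recurrence:
  "(real n + 2) * legendre_P (Suc (Suc n)) t =
     (2 * real n + 3) * t * legendre_P (Suc n) t - (real n + 1) * legendre_P n t"
  using legendre_P_Suc[of "Suc n" t] one_minus_sq_legendre_P'_Suc[of t n] by (simp add: algebra_simps)

lemma legendre_ode:
  "((\<lambda>t. (1 - t\<^sup>2) * legendre_P' n t) has_field_derivative
      - (real n * (real n + 1)) * legendre_P n t) (at t within S)"
proof -
  have "(\<lambda>t. (1 - t\<^sup>2) * legendre_P' n t) =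
          (\<lambda>t. (real n + 1) * (t * legendre_P n t) - (real n + 1) * legendre_P (Suc n) t)"
    using legendre_P_Suc[of n] by (auto simp: fun_eq_iff algebra_simps)
  moreover have "(\<dots> has_field_derivative
      (real n + 1) * (legendre_P n t + t * legendre_P' n t)
        - (real n + 1) * legendre_P' (Suc n) t) (at t within S)"
    by (auto intro!: derivative_eq_intros)
  ultimately show ?thesis
    by (simp add: legendre_P'_Suc algebra_simps)
qed

lemma legendre_P_minus: "legendre_P n (- t) = (-1) ^ n * legendre_P n t"
  and legendre_P'_minus: "legendre_P' n (- t) = (-1) ^ Suc n * legendre_P' n t"
proof (induction n)
  case (Suc n)
  have "(real n + 1) * legendre_P (Suc n) (- t) = (real n + 1) * ((-1) ^ Suc n * legendre_P (Suc n) t)"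
    unfolding mult.left_commute[of "real n + 1"] legendre_P_Suc Suc by (simp add: algebra_simps)
  then show "legendre_P (Suc n) (- t) = (-1) ^ Suc n * legendre_P (Suc n) t"
    unfolding mult_cancel_left by linarith
  show "legendre_P' (Suc n) (- t) = (-1) ^ Suc (Suc n) * legendre_P' (Suc n) t"
    unfolding legendre_P'_Suc Suc by (simp add: algebra_simps)
qed simp_all

lemma legendre_P_at_1 [simp]: "legendre_P n 1 = 1"
proof (induction n)
  case (Suc n)
  have "(real n + 1) * legendre_P (Suc n) 1 = (real n + 1) * 1"
    using legendre_P_Suc[of n 1] Suc by simp
  then show ?case
    unfolding mult_cancel_left by linarith
qed simp

lemma legendre_P_at_minus_1 [simp]: "legendre_P n (- 1) = (-1) ^ n"
  by (simp add: legendre_P_minus)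

section \<open>Central binomial coefficients and Legendre polynomials of even degree\<close>

definition central_binomial_ratio :: "nat \<Rightarrow> real" where
  "central_binomial_ratio k = real ((2 * k) choose k) / 4 ^ k"

lemma central_binomial_ratio_pochhammer:
  "central_binomial_ratio k = pochhammer (1 / 2) k / fact k"
proof -
  have "real ((2 * k) choose k) = fact (2 * k) / (fact k * fact k)"
    by (subst binomial_fact) auto
  then show ?thesis
    by (simp add: central_binomial_ratio_def fact_double power_mult)
qed

lemma central_binomial_ratio_0 [simp]: "central_binomial_ratio 0 = 1"
  by (simp add: central_binomial_ratio_def)

lemma central_binomial_ratio_pos [simp]: "central_binomial_ratio k > 0"
  by (simp add: central_binomial_ratio_def)

lemma central_binomial_ratio_nonneg [simp]: "central_binomial_ratio k \<ge> 0"
  by (rule less_imp_le) simp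

lemma central_binomial_ratio_Suc:
  "central_binomial_ratio (Suc k) = central_binomial_ratio k * (2 * real k + 1) / (2 * real k + 2)"
  by (simp add: central_binomial_ratio_pochhammer pochhammer_Suc field_simps)

lemma central_binomial_ratio_ge: "1 / (real k + 1) \<le> 2 * central_binomial_ratio k"
proof (cases "k = 0")
  case False
  have "1 / (real k + 1) \<le> 1 / real k"
    using False by (intro divide_left_mono) auto
  also have "\<dots> \<le> 2 * central_binomial_ratio k"
    using central_binomial_lower_bound[of k] False
    by (simp add: central_binomial_ratio_def field_simps)
  finally show ?thesis .
qed simp

lemma summable_central_binomial_ratio_over_Suc:
  "summable (\<lambda>k. central_binomial_ratio k / (real k + 1))"
proof -
  have diff: "2 * (central_binomial_ratio k - central_binomial_ratio (Suc k))
      = central_binomial_ratio k / (real k + 1)" for k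
    unfolding central_binomial_ratio_Suc by (simp add: field_simps)
  have "decseq central_binomial_ratio"
  proof (rule decseq_SucI)
    fix k
    have "0 \<le> central_binomial_ratio k / (real k + 1)"
      by simp
    then show "central_binomial_ratio (Suc k) \<le> central_binomial_ratio k"
      unfolding diff[symmetric] by simp
  qed
  then obtain L where "central_binomial_ratio \<longlonglongrightarrow> L"
    using decseq_convergent[of central_binomial_ratio 0] by auto
  then have "summable (\<lambda>k. 2 * (central_binomial_ratio k - central_binomial_ratio (Suc k)))"
    by (intro summable_mult sums_summable[OF telescope_sums'])
  then show ?thesis
    unfolding diff .
qed

lemma central_binomial_ratio_power_series:
  assumes "\<bar>x\<bar> < 1"
  shows "(\<lambda>k. central_binomial_ratio k * x ^ k) sums (1 / sqrt (1 - x))"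
proof -
  have "(\<lambda>k. ((-1/2) gchoose k) * (- x) ^ k) sums (1 + - x) powr (-1/2)"
    by (rule gen_binomial_real) (use assms in simp)
  moreover have "(1 + - x) powr (-1/2) = 1 / sqrt (1 - x)"
    using assms by (simp add: powr_minus_divide powr_half_sqrt)
  moreover have "((-1/2) gchoose k) * (- x) ^ k = central_binomial_ratio k * x ^ k" for k
    by (simp add: gbinomial_pochhammer central_binomial_ratio_pochhammer power_minus[of x])
  ultimately show ?thesis
    by simp
qed

lemma summable_central_binomial_ratio_power:
  "\<bar>x\<bar> < 1 \<Longrightarrow> summable (\<lambda>k. C * (central_binomial_ratio k * x ^ k))"
  by (intro summable_mult sums_summable[OF central_binomial_ratio_power_series])

lemma legendre_P_even_at_0: "legendre_P (2 * m) 0 = (-1) ^ m * central_binomial_ratio m"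
proof (induction m)
  case (Suc m)
  have "(2 * real m + 2) * legendre_P (2 * Suc m) 0 = - (2 * real m + 1) * legendre_P (2 * m) 0"
    using legendre_P_recurrence[of "2 * m" 0] by (simp add: algebra_simps)
  also have "\<dots> = (2 * real m + 2) * ((-1) ^ Suc m * central_binomial_ratio (Suc m))"
    unfolding Suc.IH central_binomial_ratio_Suc by (simp add: field_simps)
  finally show ?case
    unfolding mult_cancel_left by linarith
qed simp

text \<open>With \<open>p = 1 - t\<^sup>2\<close>, \<open>n = 2 m\<close> and \<open>y = P\<^sub>n\<close>, the energy \<open>(p y')\<^sup>2 + n (n + 1) p y\<^sup>2\<close>
  has derivative \<open>- 2 n (n + 1) t y\<^sup>2\<close> and hence is maximal at \<open>t = 0\<close>.\<close>

lemma legendre_P_even_square_bound: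
  assumes "0 \<le> t"
  shows "(1 - t\<^sup>2) * (legendre_P (2 * m) t)\<^sup>2 \<le> (central_binomial_ratio m)\<^sup>2"
proof (cases "m = 0")
  case False
  define \<kappa> where "\<kappa> = real (2 * m) * (real (2 * m) + 1)"
  have "\<kappa> > 0"
    using False by (simp add: \<kappa>_def)
  define E where
    "E t = ((1 - t\<^sup>2) * legendre_P' (2 * m) t)\<^sup>2 + \<kappa> * (1 - t\<^sup>2) * (legendre_P (2 * m) t)\<^sup>2" for t
  have "(E has_field_derivative - 2 * t * \<kappa> * (legendre_P (2 * m) t)\<^sup>2) (at t)" for t
    unfolding E_def
    by (rule derivative_eq_intros legendre_ode refl)+ (simp add: \<kappa>_def algebra_simps power2_eq_square)
  then have "E t \<le> E 0"
    using \<open>\<kappa> > 0\<close>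
    by (intro DERIV_nonpos_imp_nonincreasing[OF assms]) (auto intro!: exI simp: mult_le_0_iff)
  moreover have "legendre_P' (2 * m) 0 = 0"
    using legendre_P'_minus[of "2 * m" 0] by simp
  then have "E 0 = \<kappa> * (central_binomial_ratio m)\<^sup>2"
    by (simp add: E_def legendre_P_even_at_0 power_mult_distrib flip: power_mult power_even_eq)
  ultimately have "\<kappa> * ((1 - t\<^sup>2) * (legendre_P (2 * m) t)\<^sup>2) \<le> \<kappa> * (central_binomial_ratio m)\<^sup>2"
    unfolding E_def by (smt (verit) zero_le_power2 mult.assoc)
  then show ?thesis
    using \<open>\<kappa> > 0\<close> by simp
qed (use assms in simp)

lemma legendre_P_even_bound:
  assumes "\<bar>t\<bar> < 1"
  shows "\<bar>legendre_P (2 * m) t\<bar> \<le> central_binomial_ratio m / sqrt (1 - t\<^sup>2)"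
proof -
  have "legendre_P (2 * m) \<bar>t\<bar> = legendre_P (2 * m) t"
    using legendre_P_minus[of "2 * m" t] by (auto simp: abs_if)
  then have "(1 - t\<^sup>2) * (legendre_P (2 * m) t)\<^sup>2 \<le> (central_binomial_ratio m)\<^sup>2"
    using legendre_P_even_square_bound[of "\<bar>t\<bar>" m] by simp
  then have "sqrt ((1 - t\<^sup>2) * (legendre_P (2 * m) t)\<^sup>2) \<le> central_binomial_ratio m"
    by (intro real_le_lsqrt) auto
  moreover have "0 < 1 - t\<^sup>2"
    using assms abs_square_less_1[of t] by simp
  ultimately show ?thesis
    by (simp add: real_sqrt_mult pos_le_divide_eq mult.commute)
qed

section \<open>Functions dominated by the arcsine weight\<close>

lemma fundamental_theorem_of_calculus_Ioo:
  fixes f :: "real \<Rightarrow> 'a::banach"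
  assumes "a < b"
    and deriv: "\<And>x. x \<in> {a<..<b} \<Longrightarrow> (f has_vector_derivative f' x) (at x)"
    and right: "(f \<longlongrightarrow> A) (at_right a)" and left: "(f \<longlongrightarrow> B) (at_left b)"
  shows "(f' has_integral (B - A)) {a<..<b}"
proof -
  define g where "g x = (if x = a then A else if x = b then B else f x)" for x
  have g_eq: "g x = f x" if "x \<in> {a<..<b}" for x
    using that by (simp add: g_def)
  have "(g has_vector_derivative f' x) (at x)" if "x \<in> {a<..<b}" for x
    by (rule has_vector_derivative_transform_within_open[OF deriv open_greaterThanLessThan that])
       (use that g_eq in auto)
  moreover from this have "g \<midarrow>x\<rightarrow> g x" if "x \<in> {a<..<b}" for x
    using that has_vector_derivative_continuous isCont_def by blast
  moreover have "(g \<longlongrightarrow> A) (at_right a)"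
    by (rule Lim_transform_eventually[OF right])
       (use \<open>a < b\<close> g_eq in \<open>auto intro: eventually_mono[OF eventually_at_right_real]\<close>)
  moreover have "(g \<longlongrightarrow> B) (at_left b)"
    by (rule Lim_transform_eventually[OF left])
       (use \<open>a < b\<close> g_eq in \<open>auto intro: eventually_mono[OF eventually_at_left_real]\<close>)
  moreover have "g a = A" "g b = B"
    using \<open>a < b\<close> by (auto simp: g_def)
  ultimately have "(f' has_integral (g b - g a)) {a..b}"
    using \<open>a < b\<close> by (intro fundamental_theorem_of_calculus_interior continuous_on_IccI) auto
  then show ?thesis
    by (simp add: \<open>g a = A\<close> \<open>g b = B\<close> has_integral_Icc_iff_Ioo)
qed

lemma tendsto_at_left_1_iff_reflect:
  "(f \<longlongrightarrow> L) (at_left (1::real)) \<longleftrightarrow> ((\<lambda>x. f (1 - x)) \<longlongrightarrow> L) (at_right 0)"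
  unfolding filterlim_at_left_to_right filterlim_at_right_to_0[of _ _ "-1"] by simp

lemma has_integral_reflect_unit_interval:
  fixes f :: "real \<Rightarrow> 'a::banach"
  assumes "(f has_integral I) {0<..<1}"
  shows "((\<lambda>x. f (1 - x)) has_integral I) {0<..<1}"
proof -
  have "(f has_integral I) (cbox 0 1)"
    using assms by (simp add: has_integral_Icc_iff_Ioo)
  from has_integral_affinity[OF this, of "-1" 1] show ?thesis
    by (simp add: has_integral_Icc_iff_Ioo)
qed

definition arcsine_weight :: "real \<Rightarrow> real" where
  "arcsine_weight x = 1 / sqrt (x * (1 - x))"

lemma arcsine_weight_pos: "x \<in> {0<..<1} \<Longrightarrow> arcsine_weight x > 0"
  by (simp add: arcsine_weight_def)

lemma sqrt_one_minus_shifted_square: "sqrt (1 - (2 * x - 1)\<^sup>2) = 2 * sqrt (x * (1 - x))"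
proof -
  have "1 - (2 * x - 1)\<^sup>2 = 2\<^sup>2 * (x * (1 - x))"
    by (simp add: power2_eq_square algebra_simps)
  then show ?thesis
    by (simp only: real_sqrt_mult real_sqrt_abs abs_numeral)
qed

lemma integrable_arcsine_weight: "arcsine_weight integrable_on {0<..<1}"
proof -
  have "((\<lambda>x. arcsin (2 * x - 1)) has_vector_derivative arcsine_weight x) (at x)"
    if x: "x \<in> {0<..<1}" for x :: real
  proof -
    have "((\<lambda>x. arcsin (2 * x - 1)) has_real_derivative
        inverse (sqrt (1 - (2 * x - 1)\<^sup>2)) * 2) (at x)"
      by (rule DERIV_chain2[OF DERIV_arcsin]) (use x in \<open>auto intro!: derivative_eq_intros\<close>)
    then show ?thesis
      unfolding sqrt_one_minus_shifted_square
      by (simp add: arcsine_weight_def has_real_derivative_iff_has_vector_derivative divide_simps)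
  qed
  moreover have "continuous_on {0..1} (\<lambda>x::real. arcsin (2 * x - 1))"
    by (intro continuous_intros) auto
  ultimately have "(arcsine_weight has_integral arcsin (2 * 1 - 1) - arcsin (2 * 0 - 1)) {0..1}"
    by (intro fundamental_theorem_of_calculus_interior) auto
  then show ?thesis
    using has_integral_Icc_iff_Ioo by blast
qed

definition arcsine_dominated :: "(real \<Rightarrow> 'a::real_normed_vector) \<Rightarrow> bool" where
  "arcsine_dominated f \<longleftrightarrow>
     continuous_on {0<..<1} f \<and> (\<exists>K. \<forall>x\<in>{0<..<1}. norm (f x) \<le> K * arcsine_weight x)"

lemma arcsine_dominatedI:
  assumes "continuous_on {0<..<1} f" "\<And>x. x \<in> {0<..<1} \<Longrightarrow> norm (f x) \<le> K * arcsine_weight x"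
  shows "arcsine_dominated f"
  using assms unfolding arcsine_dominated_def by blast

lemma arcsine_dominatedE:
  assumes "arcsine_dominated f"
  obtains K where "K \<ge> 0" "continuous_on {0<..<1} f"
    "\<forall>x\<in>{0<..<1}. norm (f x) \<le> K * arcsine_weight x"
proof -
  from assms obtain K where K: "continuous_on {0<..<1} f"
    "\<And>x. x \<in> {0<..<1} \<Longrightarrow> norm (f x) \<le> K * arcsine_weight x"
    unfolding arcsine_dominated_def by blast
  have "norm (f (1 / 2)) \<le> K * arcsine_weight (1 / 2)"
    by (rule K) auto
  then have "0 \<le> K * arcsine_weight (1 / 2)"
    by (rule order.trans[OF norm_ge_zero])
  then have "K \<ge> 0"
    using arcsine_weight_pos[of "1 / 2"] by (simp add: zero_le_mult_iff)
  with K show ?thesis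
    using that by blast
qed

lemma arcsine_dominated_diff:
  assumes "arcsine_dominated f" "arcsine_dominated g"
  shows "arcsine_dominated (\<lambda>x. f x - g x)"
proof -
  obtain K where K [rule_format]: "K \<ge> 0" "continuous_on {0<..<1} f"
    "\<forall>x\<in>{0<..<1}. norm (f x) \<le> K * arcsine_weight x"
    using assms(1) by (rule arcsine_dominatedE)
  obtain L where L [rule_format]: "L \<ge> 0" "continuous_on {0<..<1} g"
    "\<forall>x\<in>{0<..<1}. norm (g x) \<le> L * arcsine_weight x"
    using assms(2) by (rule arcsine_dominatedE)
  show ?thesis
    using K(2,3) L(2,3)
    by (intro arcsine_dominatedI[of _ "K + L"] continuous_intros)
       (auto simp: distrib_right intro!: order.trans[OF norm_triangle_ineq4] add_mono)
qed

lemma (in bounded_bilinear) arcsine_dominated_left: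
  assumes "arcsine_dominated f" and g: "continuous_on {0..1} g"
  shows "arcsine_dominated (\<lambda>x. prod (f x) (g x))"
proof -
  obtain K where K [rule_format]: "K \<ge> 0" "continuous_on {0<..<1} f"
    "\<forall>x\<in>{0<..<1}. norm (f x) \<le> K * arcsine_weight x"
    using assms(1) by (rule arcsine_dominatedE)
  obtain C where C: "C \<ge> 0" "\<And>a b. norm (prod a b) \<le> norm a * norm b * C"
    using nonneg_bounded by blast
  have "bounded (g ` {0..1})"
    by (intro compact_imp_bounded compact_continuous_image g) simp
  then obtain M where M [rule_format]: "M > 0" "\<forall>x\<in>{0..1}. norm (g x) \<le> M"
    unfolding bounded_pos by blast
  show ?thesis
  proof (rule arcsine_dominatedI)
    show "continuous_on {0<..<1} (\<lambda>x. prod (f x) (g x))"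
      by (intro continuous_on K continuous_on_subset[OF g]) auto
    fix x :: real
    assume x: "x \<in> {0<..<1}"
    have "norm (prod (f x) (g x)) \<le> norm (f x) * norm (g x) * C"
      by (rule C)
    also have "\<dots> \<le> K * arcsine_weight x * M * C"
      using x M(1) M(2)[of x] K(1) K(3)[OF x] C(1) arcsine_weight_pos[OF x] by (intro mult_mono) auto
    finally show "norm (prod (f x) (g x)) \<le> K * M * C * arcsine_weight x"
      by (simp add: mult_ac)
  qed
qed

lemmas arcsine_dominated_mult_continuous =
  bounded_bilinear.arcsine_dominated_left[OF bounded_bilinear_mult]

lemmas arcsine_dominated_scaleR_continuous =
  bounded_bilinear.arcsine_dominated_left[OF bounded_bilinear.flip[OF bounded_bilinear_scaleR]]

lemma arcsine_dominated_absolutely_integrable: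
  fixes f :: "real \<Rightarrow> 'a::euclidean_space"
  assumes "arcsine_dominated f"
  shows "f absolutely_integrable_on {0<..<1}" "f integrable_on {0<..<1}"
proof -
  obtain K where K [rule_format]: "K \<ge> 0" "continuous_on {0<..<1} f"
    "\<forall>x\<in>{0<..<1}. norm (f x) \<le> K * arcsine_weight x"
    using assms by (rule arcsine_dominatedE)
  have weight: "(\<lambda>x. K * arcsine_weight x) integrable_on {0<..<1}"
    by (intro integrable_on_mult_right integrable_arcsine_weight)
  show "f integrable_on {0<..<1}"
    by (rule measurable_bounded_by_integrable_imp_integrable[OF _ weight K(3)])
       (auto intro!: continuous_imp_measurable_on_sets_lebesgue K(2))
  then show "f absolutely_integrable_on {0<..<1}"
    by (intro absolutely_integrable_integrable_bound[OF K(3) _ weight])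
qed

lemma arcsine_dominated_convergence:
  fixes f :: "nat \<Rightarrow> real \<Rightarrow> 'a::euclidean_space"
  assumes cont: "\<And>k. continuous_on {0<..<1} (f k)"
    and bound: "\<And>k x. x \<in> {0<..<1} \<Longrightarrow> norm (f k x) \<le> K * arcsine_weight x"
    and lim: "\<And>x. x \<in> {0<..<1} \<Longrightarrow> (\<lambda>k. f k x) \<longlonglongrightarrow> g x"
  shows "(\<lambda>k. integral {0<..<1} (f k)) \<longlonglongrightarrow> integral {0<..<1} g"
proof (rule dominated_convergence(2))
  show "f k integrable_on {0<..<1}" for k
    by (rule arcsine_dominated_absolutely_integrable(2)[OF arcsine_dominatedI[OF cont bound]])
  show "(\<lambda>x. K * arcsine_weight x) integrable_on {0<..<1}"
    by (intro integrable_on_mult_right integrable_arcsine_weight)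
qed (use bound lim in auto)

context
  fixes f :: "nat \<Rightarrow> real \<Rightarrow> 'a::euclidean_space" and M :: "nat \<Rightarrow> real"
  assumes cont: "\<And>m. continuous_on {0<..<1} (f m)"
    and bound: "\<And>m x. x \<in> {0<..<1} \<Longrightarrow> norm (f m x) \<le> M m * arcsine_weight x"
    and M: "summable M"
begin

lemma arcsine_dominated_summable: "x \<in> {0<..<1} \<Longrightarrow> summable (\<lambda>m. f m x)"
  by (rule summable_comparison_test'[OF summable_mult2[OF M] bound])

lemma arcsine_dominated_partial_sum_bound:
  assumes x: "x \<in> {0<..<1}"
  shows "norm (\<Sum>m<N. f m x) \<le> suminf M * arcsine_weight x"
proof -
  have M_nonneg: "0 \<le> M m" for m
    using order.trans[OF norm_ge_zero bound[OF x, of m]] arcsine_weight_pos[OF x]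
    by (simp add: zero_le_mult_iff)
  have "norm (\<Sum>m<N. f m x) \<le> (\<Sum>m<N. M m) * arcsine_weight x"
    unfolding sum_distrib_right by (intro order.trans[OF norm_sum] sum_mono bound x)
  also have "\<dots> \<le> suminf M * arcsine_weight x"
    using arcsine_weight_pos[OF x] by (intro mult_right_mono sum_le_suminf M M_nonneg) auto
  finally show ?thesis .
qed

lemma arcsine_dominated_suminf: "arcsine_dominated (\<lambda>x. \<Sum>m. f m x)"
proof (rule arcsine_dominatedI)
  show "norm (\<Sum>m. f m x) \<le> suminf M * arcsine_weight x" if x: "x \<in> {0<..<1}" for x
    by (rule tendsto_le[OF sequentially_bot tendsto_const
          tendsto_norm[OF summable_LIMSEQ[OF arcsine_dominated_summable[OF x]]]])
       (intro always_eventually allI arcsine_dominated_partial_sum_bound x)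
  let ?g = "\<lambda>m x. inverse (arcsine_weight x) *\<^sub>R f m x"
  have weight_cont: "continuous_on {0<..<1} arcsine_weight"
    unfolding arcsine_weight_def by (intro continuous_intros) auto
  have "norm (?g m x) \<le> M m" if x: "x \<in> {0<..<1}" for m x
    using bound[OF x, of m] arcsine_weight_pos[OF x] by (simp add: divide_simps mult.commute)
  then have "uniform_limit {0<..<1} (\<lambda>N x. \<Sum>m<N. ?g m x) (\<lambda>x. \<Sum>m. ?g m x) sequentially"
    by (rule Weierstrass_m_test[OF _ M])
  then have "continuous_on {0<..<1} (\<lambda>x. \<Sum>m. ?g m x)"
    by (rule uniform_limit_theorem[rotated])
       (auto intro!: always_eventually continuous_intros weight_cont cont dest: arcsine_weight_pos)
  then have "continuous_on {0<..<1} (\<lambda>x. arcsine_weight x *\<^sub>R (\<Sum>m. ?g m x))"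
    by (intro continuous_intros weight_cont)
  moreover have "arcsine_weight x *\<^sub>R (\<Sum>m. ?g m x) = (\<Sum>m. f m x)" if "x \<in> {0<..<1}" for x
    using arcsine_weight_pos[OF that]
    by (simp add: suminf_scaleR_right[OF arcsine_dominated_summable[OF that], symmetric])
  ultimately show "continuous_on {0<..<1} (\<lambda>x. \<Sum>m. f m x)"
    by (rule continuous_on_eq)
qed

lemma arcsine_dominated_integral_sums:
  "(\<lambda>m. integral {0<..<1} (f m)) sums integral {0<..<1} (\<lambda>x. \<Sum>m. f m x)"
proof -
  have "(\<lambda>N. integral {0<..<1} (\<lambda>x. \<Sum>m<N. f m x)) \<longlonglongrightarrow> integral {0<..<1} (\<lambda>x. \<Sum>m. f m x)"
    by (rule arcsine_dominated_convergence[OF _ arcsine_dominated_partial_sum_bound])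
       (auto intro!: continuous_intros cont summable_LIMSEQ arcsine_dominated_summable)
  moreover have "integral {0<..<1} (\<lambda>x. \<Sum>m<N. f m x) = (\<Sum>m<N. integral {0<..<1} (f m))" for N
    by (intro integral_sum arcsine_dominated_absolutely_integrable
          arcsine_dominatedI[OF cont bound]) auto
  ultimately show ?thesis
    by (simp add: sums_def)
qed

lemma arcsine_dominated_suminf_has_integral:
  assumes "\<And>m. (f m has_integral I m) {0<..<1}" "I sums L"
  shows "((\<lambda>x. \<Sum>m. f m x) has_integral L) {0<..<1}"
proof -
  have "I sums integral {0<..<1} (\<lambda>x. \<Sum>m. f m x)"
    using arcsine_dominated_integral_sums by (simp add: integral_unique[OF assms(1)])
  then have "integral {0<..<1} (\<lambda>x. \<Sum>m. f m x) = L"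
    using assms(2) by (rule sums_unique2)
  then show ?thesis
    using arcsine_dominated_absolutely_integrable(2)[OF arcsine_dominated_suminf] integrable_integral
    by metis
qed

end

lemma continuous_on_times_arcsine_dominated:
  assumes "arcsine_dominated f"
  shows "continuous_on {0..1} (\<lambda>x. (x * (1 - x)) *\<^sub>R f x)"
proof -
  let ?g = "\<lambda>x. (x * (1 - x)) *\<^sub>R f x"
  obtain K where K [rule_format]: "K \<ge> 0" "continuous_on {0<..<1} f"
    "\<forall>x\<in>{0<..<1}. norm (f x) \<le> K * arcsine_weight x"
    using assms(1) by (rule arcsine_dominatedE)
  have bound: "norm (?g x) \<le> K * sqrt (x * (1 - x))" if x: "x \<in> {0<..<1}" for x
  proof -
    have "norm (?g x) \<le> x * (1 - x) * (K * arcsine_weight x)"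
      using x K(3)[OF x] by (simp add: abs_mult mult_left_mono)
    moreover have "x * (1 - x) * arcsine_weight x = sqrt (x * (1 - x))"
      using x by (simp add: arcsine_weight_def real_div_sqrt)
    ultimately show ?thesis
      by (simp only: mult.left_commute[of _ K])
  qed
  have sqrt_0: "((\<lambda>x. K * sqrt (x * (1 - x))) \<longlongrightarrow> 0) (at_right 0)"
    "((\<lambda>x. K * sqrt (x * (1 - x))) \<longlongrightarrow> 0) (at_left 1)"
    by (rule tendsto_eq_intros | simp)+
  have "(?g \<longlongrightarrow> 0) (at_right 0)"
    by (rule Lim_null_comparison[OF eventually_mono[OF eventually_at_right_real[OF zero_less_one]
            bound] sqrt_0(1)])
  moreover have "(?g \<longlongrightarrow> 0) (at_left 1)"
    by (rule Lim_null_comparison[OF eventually_mono[OF eventually_at_left_real[OF zero_less_one]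
            bound] sqrt_0(2)])
  moreover have "?g \<midarrow>x\<rightarrow> ?g x" if "x \<in> {0<..<1}" for x
    using K(2) that by (intro tendsto_intros) (simp add: continuous_on_eq_continuous_at isCont_def)
  ultimately show ?thesis
    by (intro continuous_on_IccI) auto
qed

lemma Weierstrass_approximation_poly:
  fixes h :: "real \<Rightarrow> real"
  assumes "continuous_on {a..b} h" "e > 0"
  obtains p :: "real poly" where "\<And>t. t \<in> {a..b} \<Longrightarrow> \<bar>h t - poly p t\<bar> < e"
proof -
  obtain g where g: "real_polynomial_function g" "\<And>t. t \<in> {a..b} \<Longrightarrow> \<bar>h t - g t\<bar> < e"
    using Stone_Weierstrass_real_polynomial_function[OF compact_Icc assms] by blast
  obtain c n where "g = (\<lambda>t. \<Sum>i\<le>n. c i * t ^ i)"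
    using real_polynomial_function_imp_sum[OF g(1)] by blast
  then have "poly (\<Sum>i\<le>n. monom (c i) i) t = g t" for t
    by (simp add: poly_sum poly_monom)
  with g(2) show ?thesis
    using that by metis
qed

lemma arcsine_dominated_norm_integral_scaleR_le:
  fixes d :: "real \<Rightarrow> 'a::euclidean_space"
  assumes d: "arcsine_dominated d"
    and K: "\<And>x. x \<in> {0<..<1} \<Longrightarrow> norm (d x) \<le> K * arcsine_weight x"
    and g: "continuous_on {0..1} g" "\<And>x. x \<in> {0<..<1} \<Longrightarrow> \<bar>g x\<bar> \<le> e"
  shows "norm (integral {0<..<1} (\<lambda>x. g x *\<^sub>R d x)) \<le> e * (K * integral {0<..<1} arcsine_weight)"
proof -
  have "norm (integral {0<..<1} (\<lambda>x. g x *\<^sub>R d x))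
      \<le> integral {0<..<1} (\<lambda>x. e * (K * arcsine_weight x))"
  proof (rule integral_norm_bound_integral)
    show "(\<lambda>x. g x *\<^sub>R d x) integrable_on {0<..<1}"
      by (intro arcsine_dominated_absolutely_integrable arcsine_dominated_scaleR_continuous d g)
    show "(\<lambda>x. e * (K * arcsine_weight x)) integrable_on {0<..<1}"
      by (intro integrable_on_mult_right integrable_arcsine_weight)
    show "norm (g x *\<^sub>R d x) \<le> e * (K * arcsine_weight x)" if x: "x \<in> {0<..<1}" for x
      unfolding norm_scaleR using g(2)[OF x] K[OF x] by (intro mult_mono) auto
  qed
  then show ?thesis
    by simp
qed

lemma arcsine_dominated_orthogonal_continuous:
  fixes d :: "real \<Rightarrow> 'a::euclidean_space"
  assumes d: "arcsine_dominated d"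
    and orth: "\<And>p. integral {0<..<1} (\<lambda>x. poly p (2 * x - 1) *\<^sub>R d x) = 0"
    and h: "continuous_on {0..1} h"
  shows "integral {0<..<1} (\<lambda>x. h x *\<^sub>R d x) = 0"
proof -
  obtain K where K [rule_format]: "K \<ge> 0" "continuous_on {0<..<1} d"
    "\<forall>x\<in>{0<..<1}. norm (d x) \<le> K * arcsine_weight x"
    using d by (rule arcsine_dominatedE)
  have int: "(\<lambda>x. g x *\<^sub>R d x) integrable_on {0<..<1}" if "continuous_on {0..1} g" for g
    by (intro arcsine_dominated_absolutely_integrable arcsine_dominated_scaleR_continuous d that)
  define W where "W = K * integral {0<..<1} arcsine_weight"
  have "norm (integral {0<..<1} (\<lambda>x. h x *\<^sub>R d x)) \<le> e * W" if "e > 0" for e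
  proof -
    have "continuous_on {-1..1} (\<lambda>t. h ((1 + t) / 2))"
      by (intro continuous_on_compose2[OF h] continuous_intros) auto
    then obtain p where p: "\<And>t. t \<in> {-1..1} \<Longrightarrow> \<bar>h ((1 + t) / 2) - poly p t\<bar> < e"
      using Weierstrass_approximation_poly \<open>e > 0\<close> by blast
    have "\<bar>h x - poly p (2 * x - 1)\<bar> \<le> e" if "x \<in> {0<..<1}" for x
      using p[of "2 * x - 1"] that by simp
    then have "norm (integral {0<..<1} (\<lambda>x. (h x - poly p (2 * x - 1)) *\<^sub>R d x)) \<le> e * W"
      unfolding W_def
      by (intro arcsine_dominated_norm_integral_scaleR_le d K(3) continuous_intros h)
    then show ?thesis
      by (simp add: scaleR_diff_left integral_diff int h orth continuous_intros)
  qed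
  moreover have "((\<lambda>e. e * W) \<longlongrightarrow> 0) (at_right 0)"
    by (rule tendsto_eq_intros refl | simp)+
  ultimately have "norm (integral {0<..<1} (\<lambda>x. h x *\<^sub>R d x)) \<le> 0"
    by (intro tendsto_lowerbound[of "\<lambda>e. e * W" 0 "at_right 0"])
       (auto intro!: eventually_mono[OF eventually_at_right_less])
  then show ?thesis
    by simp
qed

text \<open>\<open>d\<close> may be unbounded at the endpoints, but \<open>x (1 - x) d(x)\<close> extends continuously, so that
  \<open>d\<close> can be tested against \<open>(x (1 - x))\<^sup>2 d(x)\<close>.\<close>

lemma arcsine_dominated_eq_0_if_orthogonal_polynomials:
  fixes d :: "real \<Rightarrow> 'a::euclidean_space"
  assumes d: "arcsine_dominated d"
    and orth: "\<And>p. integral {0<..<1} (\<lambda>x. poly p (2 * x - 1) *\<^sub>R d x) = 0"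
    and x: "x \<in> {0<..<1}"
  shows "d x = 0"
proof (rule euclidean_eqI)
  fix b :: 'a
  assume "b \<in> Basis"
  define g where "g x = x * (1 - x) * (d x \<bullet> b)" for x
  have "continuous_on {0..1} (\<lambda>x. ((x * (1 - x)) *\<^sub>R d x) \<bullet> b)"
    by (intro continuous_intros continuous_on_times_arcsine_dominated d)
  then have g: "continuous_on {0..1} g"
    by (simp add: g_def[abs_def])
  then have h: "continuous_on {0..1} (\<lambda>x. x * (1 - x) * g x)"
    by (intro continuous_intros)
  have "((\<lambda>x. (x * (1 - x) * g x) *\<^sub>R d x) has_integral 0) {0<..<1}"
    using arcsine_dominated_orthogonal_continuous[OF d orth h]
      arcsine_dominated_absolutely_integrable(2)[OF arcsine_dominated_scaleR_continuous[OF d h]]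
    by (metis integrable_integral)
  from has_integral_linear[OF this bounded_linear_inner_left]
  have "((\<lambda>x. (g x)\<^sup>2) has_integral 0) {0..1}"
    by (simp add: o_def g_def power2_eq_square mult_ac has_integral_Icc_iff_Ioo)
  moreover have "continuous_on {0..1} (\<lambda>x. (g x)\<^sup>2)"
    by (intro continuous_intros g)
  ultimately have "(g x)\<^sup>2 = 0"
    using has_integral_0_cbox_imp_0[of 0 1 "\<lambda>x. (g x)\<^sup>2" x] x by auto
  then show "d x \<bullet> b = 0 \<bullet> b"
    using x by (auto simp: g_def)
qed

section \<open>Legendre's equation on the unit interval\<close>

text \<open>Here \<open>U\<close> is the flux \<open>x (1 - x) u'\<close>; with it \<open>(x (1 - x) u')' = - l u\<close> is a first-order system,
  so no second derivatives are needed.\<close>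

definition legendre_system :: "complex \<Rightarrow> (real \<Rightarrow> complex) \<Rightarrow> (real \<Rightarrow> complex) \<Rightarrow> bool" where
  "legendre_system l u U \<longleftrightarrow> (\<forall>x\<in>{0<..<1}.
     (u has_vector_derivative U x / of_real (x * (1 - x))) (at x) \<and>
     (U has_vector_derivative - l * u x) (at x))"

lemma legendre_systemD:
  assumes "legendre_system l u U" "x \<in> {0<..<1}"
  shows "(u has_vector_derivative U x * (1 / of_real (x * (1 - x)))) (at x)"
    and "(U has_vector_derivative - l * u x) (at x)"
  using assms by (auto simp: legendre_system_def)

lemma legendre_system_reflect:
  assumes "legendre_system l u U"
  shows "legendre_system l (\<lambda>x. u (1 - x)) (\<lambda>x. - U (1 - x))"
  unfolding legendre_system_def
proof (intro ballI conjI)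
  fix x :: real
  assume "x \<in> {0<..<1}"
  then have x: "1 - x \<in> {0<..<1}"
    by simp
  have reflect: "((\<lambda>x. 1 - x) has_vector_derivative (-1::real)) (at x)"
    by (auto intro!: derivative_eq_intros)
  show "((\<lambda>x. u (1 - x)) has_vector_derivative - U (1 - x) / of_real (x * (1 - x))) (at x)"
    using vector_diff_chain_at[OF reflect legendre_systemD(1)[OF assms x]]
    by (simp add: o_def mult.commute)
  show "((\<lambda>x. - U (1 - x)) has_vector_derivative - l * u (1 - x)) (at x)"
    using has_vector_derivative_minus[OF
        vector_diff_chain_at[OF reflect legendre_systemD(2)[OF assms x]]]
    by (simp add: o_def)
qed

lemma legendre_system_continuous_on:
  assumes "legendre_system l u U"
  shows "continuous_on {0<..<1} u"
  by (intro continuous_at_imp_continuous_on ballI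
        has_vector_derivative_continuous[OF legendre_systemD(1)[OF assms]])

lemma legendre_system_green:
  assumes u: "legendre_system k u U" and v: "legendre_system l v V"
    and right: "((\<lambda>x. U x * v x - u x * V x) \<longlongrightarrow> A) (at_right 0)"
    and left: "((\<lambda>x. U x * v x - u x * V x) \<longlongrightarrow> B) (at_left 1)"
  shows "((\<lambda>x. (l - k) * (u x * v x)) has_integral (B - A)) {0<..<1}"
proof (rule fundamental_theorem_of_calculus_Ioo[OF _ _ right left])
  fix x :: real
  assume x: "x \<in> {0<..<1}"
  show "((\<lambda>x. U x * v x - u x * V x) has_vector_derivative (l - k) * (u x * v x)) (at x)"
    by (rule derivative_eq_intros legendre_systemD[OF u x] legendre_systemD[OF v x] refl)+
       (simp add: algebra_simps)
qed simp

text \<open>The product \<open>w\<close> of two solutions solves the third-order symmetric square of the equation;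
  integrating that by parts three times against \<open>y\<close> leaves the boundary terms \<open>B\<close>.\<close>

lemma legendre_system_symmetric_square:
  assumes u: "legendre_system l u U" and v: "legendre_system l v V" and y: "legendre_system k y Y"
  defines "B \<equiv> \<lambda>x. 2 * (U x * V x) * y x + (2 * l - k) * (of_real (x * (1 - x)) * (u x * v x)) * y x
      - (u x * V x + U x * v x) * Y x"
  assumes right: "(B \<longlongrightarrow> 0) (at_right 0)" and left: "(B \<longlongrightarrow> 0) (at_left 1)"
  shows "((\<lambda>x. u x * v x * ((2 * l - k) * ((1 - 2 * of_real x) * y x + Y x) + 2 * l * Y x))
           has_integral 0) {0<..<1}"
proof -
  have "(B has_vector_derivative
      u x * v x * ((2 * l - k) * ((1 - 2 * of_real x) * y x + Y x) + 2 * l * Y x)) (at x)"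
    if x: "x \<in> {0<..<1}" for x
  proof -
    define q where "q = complex_of_real (x * (1 - x))"
    define r where "r = 1 / q"
    have qr: "q * r = 1"
      using x by (simp add: q_def r_def)
    have dq: "((\<lambda>x. complex_of_real (x * (1 - x))) has_vector_derivative of_real (1 - 2 * x)) (at x)"
      by (rule has_vector_derivative_of_real)
         (auto intro!: derivative_eq_intros simp flip: has_real_derivative_iff_has_vector_derivative)
    have double: "complex_of_real (1 - 2 * x) = 1 - 2 * of_real x"
      by simp
    show ?thesis
      unfolding B_def
      by (rule derivative_eq_intros dq refl
            legendre_systemD[OF u x, folded q_def r_def] legendre_systemD[OF v x, folded q_def r_def]
            legendre_systemD[OF y x, folded q_def r_def])+
         (unfold double, fold q_def, use qr in algebra)
  qed
  then have "((\<lambda>x. u x * v x * ((2 * l - k) * ((1 - 2 * of_real x) * y x + Y x) + 2 * l * Y x))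
      has_integral (0 - 0)) {0<..<1}"
    using right left by (intro fundamental_theorem_of_calculus_Ioo) auto
  then show ?thesis
    by simp
qed

definition shifted_legendre :: "nat \<Rightarrow> real \<Rightarrow> complex" where
  "shifted_legendre n x = of_real (legendre_P n (2 * x - 1))"

definition shifted_legendre_flux :: "nat \<Rightarrow> real \<Rightarrow> complex" where
  "shifted_legendre_flux n x = of_real ((1 - (2 * x - 1)\<^sup>2) * legendre_P' n (2 * x - 1) / 2)"

lemma legendre_system_shifted_legendre:
  "legendre_system (of_nat n * (of_nat n + 1)) (shifted_legendre n) (shifted_legendre_flux n)"
  unfolding legendre_system_def
proof (intro ballI conjI)
  fix x :: real
  assume x: "x \<in> {0<..<1}"
  have "((\<lambda>x. legendre_P n (2 * x - 1)) has_real_derivative 2 * legendre_P' n (2 * x - 1)) (at x)"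
    by (auto intro!: derivative_eq_intros)
  then have "(shifted_legendre n has_vector_derivative of_real (2 * legendre_P' n (2 * x - 1))) (at x)"
    unfolding shifted_legendre_def[abs_def]
    by (intro has_vector_derivative_of_real) (simp add: has_real_derivative_iff_has_vector_derivative)
  moreover have "(1 - (2 * x - 1)\<^sup>2) * legendre_P' n (2 * x - 1) / 2
      = x * (1 - x) * (2 * legendre_P' n (2 * x - 1))"
    by (simp add: power2_eq_square field_simps)
  then have "complex_of_real (2 * legendre_P' n (2 * x - 1)) =
      shifted_legendre_flux n x / of_real (x * (1 - x))"
    using x unfolding shifted_legendre_flux_def by (simp only:) simp
  ultimately show "(shifted_legendre n has_vector_derivative
      shifted_legendre_flux n x / of_real (x * (1 - x))) (at x)"
    by (simp only:)
  have "((\<lambda>x. (1 - (2 * x - 1)\<^sup>2) * legendre_P' n (2 * x - 1)) has_real_derivative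
      - (real n * (real n + 1)) * legendre_P n (2 * x - 1) * 2) (at x)"
    by (rule DERIV_chain2[OF legendre_ode]) (auto intro!: derivative_eq_intros)
  from DERIV_cdivide[OF this, of 2]
  have "((\<lambda>x. (1 - (2 * x - 1)\<^sup>2) * legendre_P' n (2 * x - 1) / 2) has_real_derivative
      - (real n * (real n + 1)) * legendre_P n (2 * x - 1)) (at x)"
    by simp
  then have "(shifted_legendre_flux n has_vector_derivative
      of_real (- (real n * (real n + 1)) * legendre_P n (2 * x - 1))) (at x)"
    unfolding shifted_legendre_flux_def[abs_def]
    by (intro has_vector_derivative_of_real) (simp add: has_real_derivative_iff_has_vector_derivative)
  then show "(shifted_legendre_flux n has_vector_derivative
      - (of_nat n * (of_nat n + 1)) * shifted_legendre n x) (at x)"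
    by (simp add: shifted_legendre_def)
qed

lemma continuous_on_shifted_legendre [continuous_intros]:
  "continuous_on S (shifted_legendre n)" "continuous_on S (shifted_legendre_flux n)"
  unfolding shifted_legendre_def[abs_def] shifted_legendre_flux_def[abs_def]
  by (intro continuous_intros; simp)+

lemma tendsto_shifted_legendre [tendsto_intros]:
  assumes "(f \<longlongrightarrow> x) F"
  shows "((\<lambda>z. shifted_legendre n (f z)) \<longlongrightarrow> shifted_legendre n x) F"
    and "((\<lambda>z. shifted_legendre_flux n (f z)) \<longlongrightarrow> shifted_legendre_flux n x) F"
  using continuous_on_shifted_legendre[of UNIV n] assms
  by (auto simp: continuous_on_eq_continuous_at intro: isCont_tendsto_compose)

lemma shifted_legendre_0 [simp]: "shifted_legendre 0 x = 1"
  by (simp add: shifted_legendre_def)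

lemma shifted_legendre_flux_endpoints [simp]:
  "shifted_legendre_flux n 0 = 0" "shifted_legendre_flux n 1 = 0"
  by (simp_all add: shifted_legendre_flux_def)

lemma shifted_legendre_reflect: "shifted_legendre n (1 - x) = (-1) ^ n * shifted_legendre n x"
proof -
  have "2 * (1 - x) - 1 = - (2 * x - 1)"
    by simp
  then show ?thesis
    unfolding shifted_legendre_def by (simp only: legendre_P_minus) simp
qed

lemma shifted_legendre_recurrence:
  "(of_nat n + 2) * shifted_legendre (Suc (Suc n)) x =
     (2 * of_nat n + 3) * (2 * of_real x - 1) * shifted_legendre (Suc n) x
     - (of_nat n + 1) * shifted_legendre n x"
  using arg_cong[OF legendre_P_recurrence[of n "2 * x - 1"], of complex_of_real]
  by (simp add: shifted_legendre_def)

lemma shifted_legendre_flux_Suc: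
  "2 * shifted_legendre_flux (Suc n) x =
     (of_nat n + 1) * (shifted_legendre n x - (2 * of_real x - 1) * shifted_legendre (Suc n) x)"
  using arg_cong[OF one_minus_sq_legendre_P'_Suc[of "2 * x - 1" n], of complex_of_real]
  by (simp add: shifted_legendre_flux_def shifted_legendre_def)

lemma norm_shifted_legendre_even_le:
  assumes "x \<in> {0<..<1}"
  shows "norm (shifted_legendre (2 * m) x) \<le> central_binomial_ratio m / 2 * arcsine_weight x"
proof -
  have "\<bar>2 * x - 1\<bar> < 1"
    using assms by (auto simp: abs_if)
  then show ?thesis
    using legendre_P_even_bound[of "2 * x - 1" m]
    by (simp add: shifted_legendre_def arcsine_weight_def sqrt_one_minus_shifted_square)
qed

lemma shifted_legendre_bounded:
  obtains A where "A > 0" "\<And>x. x \<in> {0..1} \<Longrightarrow> norm (shifted_legendre n x) \<le> A"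
proof -
  have "bounded (shifted_legendre n ` {0..1})"
    by (intro compact_imp_bounded compact_continuous_image continuous_intros) simp
  then show ?thesis
    unfolding bounded_pos using that by blast
qed

lemma shifted_legendre_orthogonal:
  assumes "n \<noteq> m"
  shows "((\<lambda>x. shifted_legendre n x * shifted_legendre m x) has_integral 0) {0<..<1}"
proof -
  define \<kappa> :: "nat \<Rightarrow> complex" where "\<kappa> j = of_nat j * (of_nat j + 1)" for j
  have "((\<lambda>x. (\<kappa> m - \<kappa> n) * (shifted_legendre n x * shifted_legendre m x))
      has_integral (0 - 0)) {0<..<1}"
    unfolding \<kappa>_def
    by (rule legendre_system_green[OF legendre_system_shifted_legendre
          legendre_system_shifted_legendre], (rule tendsto_eq_intros refl | simp)+)
  moreover have "\<kappa> m \<noteq> \<kappa> n"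
  proof -
    have "\<kappa> m - \<kappa> n = (of_nat m - of_nat n) * of_nat (m + n + 1)"
      by (simp add: \<kappa>_def algebra_simps)
    moreover have "of_nat (m + n + 1) \<noteq> (0::complex)"
      by (simp only: of_nat_eq_0_iff)
    ultimately show ?thesis
      using assms by (metis mult_eq_0_iff of_nat_eq_iff right_minus_eq)
  qed
  ultimately show ?thesis
    by (simp add: has_integral_mult_right_iff)
qed

text \<open>For \<open>p = P\<^sub>n\<close> and \<open>r = P\<^sub>n\<^sub>+\<^sub>1\<close>, the function \<open>t (r\<^sup>2 + p\<^sup>2) / 2 - r p\<close> vanishes at
  \<open>1\<close> and \<open>-1\<close> and has derivative \<open>(n + 3 / 2) r\<^sup>2 - (n + 1 / 2) p\<^sup>2\<close>.\<close>

lemma legendre_P_square_integral: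
  "((\<lambda>x. (2 * real n + 1) * (legendre_P n (2 * x - 1))\<^sup>2) has_integral 1) {0..1}"
proof (induction n)
  case 0
  show ?case
    using has_integral_const_real[of "1::real" 0 1] by simp
next
  case (Suc n)
  define B where "B t = 1 / 2 * (t * ((legendre_P (Suc n) t)\<^sup>2 + (legendre_P n t)\<^sup>2))
      - legendre_P (Suc n) t * legendre_P n t" for t
  have B': "(B has_real_derivative ((2 * real n + 3) * (legendre_P (Suc n) t)\<^sup>2
      - (2 * real n + 1) * (legendre_P n t)\<^sup>2) / 2) (at t)" for t
    unfolding B_def
    by (rule derivative_eq_intros refl)+
       (simp add: field_simps, use legendre_P'_Suc[of n t] legendre_P_Suc[of n t] in algebra)
  have "((\<lambda>x. B (2 * x - 1)) has_real_derivative (2 * real n + 3) * (legendre_P (Suc n) (2 * x - 1))\<^sup>2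
      - (2 * real n + 1) * (legendre_P n (2 * x - 1))\<^sup>2) (at x within {0..1})" for x
    by (rule DERIV_cong[OF DERIV_chain2[OF B']]) (auto intro!: derivative_eq_intros)
  then have "((\<lambda>x. (2 * real n + 3) * (legendre_P (Suc n) (2 * x - 1))\<^sup>2
      - (2 * real n + 1) * (legendre_P n (2 * x - 1))\<^sup>2)
      has_integral (B (2 * 1 - 1) - B (2 * 0 - 1))) {0..1}"
    by (intro fundamental_theorem_of_calculus)
       (auto simp: has_real_derivative_iff_has_vector_derivative)
  from has_integral_add[OF this Suc.IH] show ?case
    by (simp add: B_def power2_eq_square algebra_simps)
qed

lemma double_of_nat_plus_1_neq_0: "2 * of_nat n + 1 \<noteq> (0 :: 'a::semiring_char_0)"
  using of_nat_neq_0[of "2 * n", where 'a = 'a] by (simp add: add.commute)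

lemma shifted_legendre_inner_product:
  "((\<lambda>x. shifted_legendre n x * shifted_legendre m x) has_integral
     (if n = m then 1 / (2 * of_nat n + 1) else 0)) {0<..<1}"
proof (cases "n = m")
  case True
  have "((\<lambda>x. complex_of_real ((2 * real n + 1) * (legendre_P n (2 * x - 1))\<^sup>2))
      has_integral of_real 1) {0..1}"
    by (intro has_integral_of_real legendre_P_square_integral)
  then have "((\<lambda>x. (2 * of_nat n + 1) * (shifted_legendre n x * shifted_legendre n x))
      has_integral 1) {0<..<1}"
    by (simp add: shifted_legendre_def power2_eq_square has_integral_Icc_iff_Ioo)
  with True show ?thesis
    by (simp add: has_integral_mult_right_iff[OF double_of_nat_plus_1_neq_0])
qed (simp add: shifted_legendre_orthogonal)

lemma arcsine_dominated_eq_0_if_orthogonal_legendre: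
  assumes d: "arcsine_dominated d"
    and orth: "\<And>n. ((\<lambda>x. d x * shifted_legendre n x) has_integral 0) {0<..<1}"
    and x: "x \<in> {0<..<1}"
  shows "d x = 0"
proof (rule arcsine_dominated_eq_0_if_orthogonal_polynomials[OF d _ x])
  fix p :: "real poly"
  have "((\<lambda>x. poly p (2 * x - 1) *\<^sub>R d x) has_integral 0) {0<..<1}"
  proof (induction p rule: legendre_poly_induct)
    case (add p c n)
    have "((\<lambda>x. poly p (2 * x - 1) *\<^sub>R d x + of_real c * (d x * shifted_legendre n x))
        has_integral 0 + of_real c * 0) {0<..<1}"
      by (intro has_integral_add add.IH has_integral_mult_right orth)
    then show ?case
      by (simp add: shifted_legendre_def legendre_P_def scaleR_conv_of_real algebra_simps)
  qed simp
  then show "integral {0<..<1} (\<lambda>x. poly p (2 * x - 1) *\<^sub>R d x) = 0"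
    by (rule integral_unique)
qed

section \<open>The Legendre function\<close>

lemma norm_le_over_Suc_if_convergent:
  fixes a :: "nat \<Rightarrow> 'a::real_normed_field"
  assumes "(\<lambda>k. of_nat k * a k) \<longlonglongrightarrow> L"
  obtains C where "C > 0" "\<And>k. norm (a k) \<le> C / (real k + 1)"
proof -
  obtain K where K: "K > 0" "\<And>k. norm (of_nat k * a k) \<le> K"
    using convergent_imp_Bseq[OF convergentI[OF assms]] by (auto simp: Bseq_def)
  have "norm (a k) \<le> (2 * K + norm (a 0)) / (real k + 1)" for k
  proof (cases "k = 0")
    case False
    then have "(real k + 1) * norm (a k) \<le> 2 * real k * norm (a k)"
      by (intro mult_right_mono) auto
    also have "\<dots> \<le> 2 * K + norm (a 0)"
      using K(2)[of k] by (simp add: norm_mult add_increasing2)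
    finally show ?thesis
      by (simp add: pos_le_divide_eq mult.commute)
  qed (use K in simp)
  moreover have "2 * K + norm (a 0) > 0"
    using K(1) by (simp add: add_pos_nonneg)
  ultimately show ?thesis
    using that by blast
qed

abbreviation legendre_fps :: "complex \<Rightarrow> complex fps" where
  "legendre_fps \<nu> \<equiv> hyp2F1_fps (- \<nu>) (\<nu> + 1) 1"

definition legendre_fun_coeff :: "complex \<Rightarrow> nat \<Rightarrow> complex" where
  "legendre_fun_coeff \<nu> k = fps_nth (legendre_fps \<nu>) k"

lemma legendre_fun_coeff_pochhammer:
  "legendre_fun_coeff \<nu> k = pochhammer (- \<nu>) k * pochhammer (\<nu> + 1) k / (fact k)\<^sup>2"
  by (simp add: legendre_fun_coeff_def hyp2F1_fps_def power2_eq_square flip: pochhammer_fact)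

lemma legendre_fun_coeff_0 [simp]: "legendre_fun_coeff \<nu> 0 = 1"
  by (simp add: legendre_fun_coeff_pochhammer)

lemma legendre_fun_coeff_Suc:
  "(of_nat k + 1)\<^sup>2 * legendre_fun_coeff \<nu> (Suc k) =
     (of_nat k * (of_nat k + 1) - \<nu> * (\<nu> + 1)) * legendre_fun_coeff \<nu> k"
proof -
  have "(of_nat k + 1 :: complex) \<noteq> 0"
    by (metis of_nat_Suc of_nat_neq_0 add.commute)
  then show ?thesis
    by (simp add: legendre_fun_coeff_pochhammer pochhammer_Suc power_mult_distrib divide_simps)
       (simp add: algebra_simps)
qed

lemma legendre_fun_coeff_minus_half:
  "legendre_fun_coeff (- 1 / 2) k = (of_real (central_binomial_ratio k))\<^sup>2"
proof -
  have "complex_of_real (pochhammer (1 / 2) k) = pochhammer (1 / 2) k"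
    using pochhammer_of_real[of "1 / 2" k, where 'a = complex] by simp
  then show ?thesis
    by (simp add: legendre_fun_coeff_pochhammer central_binomial_ratio_pochhammer power2_eq_square)
qed

lemma legendre_fun_coeff_Int_eventually_0:
  assumes "\<nu> \<in> \<int>"
  obtains K where "\<And>k. k \<ge> K \<Longrightarrow> legendre_fun_coeff \<nu> k = 0"
proof -
  obtain j where j: "\<nu> = of_int j"
    using assms by (auto elim: Ints_cases)
  show ?thesis
  proof (rule that)
    fix k
    assume k: "nat \<bar>j\<bar> + 1 \<le> k"
    show "legendre_fun_coeff \<nu> k = 0"
    proof (cases "j \<ge> 0")
      case True
      then have "- \<nu> = - of_nat (nat j)"
        by (simp add: j)
      then have "pochhammer (- \<nu>) k = 0"
        using k by (simp only: pochhammer_of_nat_eq_0_iff)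
      then show ?thesis
        by (simp add: legendre_fun_coeff_pochhammer)
    next
      case False
      then have "\<nu> + 1 = - of_nat (nat (- j - 1))"
        by (simp add: j)
      then have "pochhammer (\<nu> + 1) k = 0"
        using k False by (simp only: pochhammer_of_nat_eq_0_iff)
      then show ?thesis
        by (simp add: legendre_fun_coeff_pochhammer)
    qed
  qed
qed

lemma legendre_fun_coeff_limit:
  "(\<lambda>k. of_nat k * legendre_fun_coeff \<nu> k) \<longlonglongrightarrow> - sin (of_real pi * \<nu>) / of_real pi"
proof -
  have "(\<lambda>n. rGamma_series (- \<nu>) n * rGamma_series (\<nu> + 1) n * (of_nat n / of_nat (Suc n)))
          \<longlonglongrightarrow> rGamma (- \<nu>) * rGamma (\<nu> + 1) * 1"
    by (intro tendsto_mult rGamma_series_LIMSEQ LIMSEQ_n_over_Suc_n)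
  moreover have "\<forall>\<^sub>F n in sequentially.
      rGamma_series (- \<nu>) n * rGamma_series (\<nu> + 1) n * (of_nat n / of_nat (Suc n))
        = of_nat (Suc n) * legendre_fun_coeff \<nu> (Suc n)"
    using eventually_gt_at_top[of 0]
  proof eventually_elim
    case (elim n)
    have "rGamma_series (- \<nu>) n * rGamma_series (\<nu> + 1) n
        = pochhammer (- \<nu>) (Suc n) * pochhammer (\<nu> + 1) (Suc n) / ((fact n)\<^sup>2 *
           (exp (- \<nu> * of_real (ln (real n))) * exp ((\<nu> + 1) * of_real (ln (real n)))))"
      by (simp add: rGamma_series_def power2_eq_square)
    also have "exp (- \<nu> * of_real (ln (real n))) * exp ((\<nu> + 1) * of_real (ln (real n))) = of_nat n"
      using elim by (simp add: exp_add[symmetric] algebra_simps exp_of_real)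
    finally show ?case
      using elim
      by (simp add: legendre_fun_coeff_pochhammer power_mult_distrib power2_eq_square
          del: pochhammer_Suc of_nat_Suc)
  qed
  ultimately have "(\<lambda>n. of_nat (Suc n) * legendre_fun_coeff \<nu> (Suc n))
      \<longlonglongrightarrow> rGamma (- \<nu>) * rGamma (\<nu> + 1) * 1"
    by (rule Lim_transform_eventually)
  moreover have "rGamma (- \<nu>) * rGamma (\<nu> + 1) = - sin (of_real pi * \<nu>) / of_real pi"
    using rGamma_reflection_complex[of "- \<nu>"] by (simp add: add.commute)
  ultimately show ?thesis
    by (subst (asm) filterlim_sequentially_Suc) simp
qed

text \<open>For \<open>\<mu> (\<mu> + 1) = - \<Lambda>\<close> every factor \<open>k (k + 1) - \<mu> (\<mu> + 1)\<close> of the recurrence is the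
  largest value that \<open>\<bar>k (k + 1) - \<nu> (\<nu> + 1)\<bar>\<close> can take when \<open>\<bar>\<nu> (\<nu> + 1)\<bar> \<le> \<Lambda>\<close>.\<close>

lemma norm_legendre_fun_coeff_le:
  assumes "norm (\<nu> * (\<nu> + 1)) \<le> \<Lambda>" and \<mu>: "\<mu> * (\<mu> + 1) = - of_real \<Lambda>"
  shows "norm (legendre_fun_coeff \<nu> k) \<le> norm (legendre_fun_coeff \<mu> k)"
proof (induction k)
  case (Suc k)
  define r where "r = real k * (real k + 1)"
  have "\<Lambda> \<ge> 0"
    using assms(1) norm_ge_zero order.trans by blast
  have square: "norm ((of_nat k + 1 :: complex)\<^sup>2) = (real k + 1)\<^sup>2"
    by (metis norm_of_nat norm_power of_nat_1 of_nat_add)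
  have step: "(real k + 1)\<^sup>2 * norm (legendre_fun_coeff \<sigma> (Suc k))
      = norm (of_real r - \<sigma> * (\<sigma> + 1)) * norm (legendre_fun_coeff \<sigma> k)" for \<sigma>
    using arg_cong[OF legendre_fun_coeff_Suc[of k \<sigma>], of norm]
    unfolding norm_mult square by (simp add: r_def norm_mult)
  have "norm (of_real r - \<nu> * (\<nu> + 1)) \<le> norm (complex_of_real r) + norm (\<nu> * (\<nu> + 1))"
    by (rule norm_triangle_ineq4)
  also have "\<dots> \<le> r + \<Lambda>"
    using assms(1) by (simp add: r_def del: of_real_mult)
  also have "r + \<Lambda> = norm (complex_of_real (r + \<Lambda>))"
    using \<open>\<Lambda> \<ge> 0\<close> unfolding norm_of_real by (simp add: r_def)
  also have "complex_of_real (r + \<Lambda>) = of_real r - \<mu> * (\<mu> + 1)"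
    by (simp add: \<mu>)
  finally have "(real k + 1)\<^sup>2 * norm (legendre_fun_coeff \<nu> (Suc k))
      \<le> (real k + 1)\<^sup>2 * norm (legendre_fun_coeff \<mu> (Suc k))"
    unfolding step using Suc by (intro mult_mono) auto
  then show ?case
    by (rule mult_left_le_imp_le) simp
qed simp

lemma legendre_fun_coeff_bound:
  "\<exists>C>0. \<forall>\<nu> k. norm (\<nu> * (\<nu> + 1)) \<le> \<Lambda> \<longrightarrow>
     norm (legendre_fun_coeff \<nu> k) \<le> C * central_binomial_ratio k"
proof -
  define \<mu> where "\<mu> = (csqrt (1 - 4 * of_real \<Lambda>) - 1) / 2"
  have "(csqrt (1 - 4 * of_real \<Lambda>))\<^sup>2 = 1 - 4 * of_real \<Lambda>"
    by simp
  then have \<mu>: "\<mu> * (\<mu> + 1) = - of_real \<Lambda>"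
    unfolding \<mu>_def by (simp add: field_simps power2_eq_square)
  obtain C where C: "C > 0" "\<And>k. norm (legendre_fun_coeff \<mu> k) \<le> C / (real k + 1)"
    by (rule norm_le_over_Suc_if_convergent[OF legendre_fun_coeff_limit[of \<mu>]]) (rule that)
  show ?thesis
  proof (intro exI[of _ "2 * C"] conjI allI impI)
    show "2 * C > 0"
      using C by simp
    fix \<nu> :: complex and k
    assume "norm (\<nu> * (\<nu> + 1)) \<le> \<Lambda>"
    then have "norm (legendre_fun_coeff \<nu> k) \<le> C / (real k + 1)"
      using norm_legendre_fun_coeff_le[OF _ \<mu>] C(2) order.trans by blast
    also have "\<dots> \<le> 2 * C * central_binomial_ratio k"
      using mult_left_mono[OF central_binomial_ratio_ge[of k], of C] C(1) by simp
    finally show "norm (legendre_fun_coeff \<nu> k) \<le> 2 * C * central_binomial_ratio k" .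
  qed
qed

lemma norm_mult_power_le:
  fixes c :: complex
  assumes "norm c \<le> C * b" "0 \<le> x"
  shows "norm (c * of_real x ^ k) \<le> C * (b * x ^ k)"
  using assms by (simp add: norm_mult norm_power mult.assoc[symmetric] mult_right_mono)

definition legendre_fun :: "complex \<Rightarrow> real \<Rightarrow> complex" where
  "legendre_fun \<nu> x = hyp2F1 (- \<nu>) (\<nu> + 1) 1 (of_real x)"

abbreviation legendre_flux_fps :: "complex \<Rightarrow> complex fps" where
  "legendre_flux_fps \<nu> \<equiv> fps_X * (1 - fps_X) * fps_deriv (legendre_fps \<nu>)"

definition legendre_fun_flux :: "complex \<Rightarrow> real \<Rightarrow> complex" where
  "legendre_fun_flux \<nu> x = eval_fps (legendre_flux_fps \<nu>) (of_real x)"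

lemma legendre_fun_eq_suminf: "legendre_fun \<nu> x = (\<Sum>k. legendre_fun_coeff \<nu> k * of_real x ^ k)"
  by (simp add: legendre_fun_def hyp2F1_def eval_fps_def legendre_fun_coeff_def)

lemma legendre_fun_0 [simp]: "legendre_fun \<nu> 0 = 1"
  by (simp add: legendre_fun_def hyp2F1_def eval_fps_at_0 hyp2F1_fps_def)

lemma legendre_fun_flux_0 [simp]: "legendre_fun_flux \<nu> 0 = 0"
  by (simp add: legendre_fun_flux_def eval_fps_at_0)

lemma fps_conv_radius_legendre_fps: "fps_conv_radius (legendre_fps \<nu>) \<ge> 1"
  unfolding fps_conv_radius_def
proof (rule conv_radius_geI_ex')
  fix r :: real
  assume r: "0 < r" "ereal r < 1"
  obtain C where C: "\<And>k. norm (legendre_fun_coeff \<nu> k) \<le> C * central_binomial_ratio k"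
    using legendre_fun_coeff_bound[of "norm (\<nu> * (\<nu> + 1))"] by (meson order.refl)
  have "summable (\<lambda>k. C * (central_binomial_ratio k * r ^ k))"
    using r by (intro summable_central_binomial_ratio_power) auto
  then show "summable (\<lambda>k. fps_nth (legendre_fps \<nu>) k * of_real r ^ k)"
    unfolding legendre_fun_coeff_def[symmetric]
    by (rule summable_comparison_test') (use r in \<open>intro norm_mult_power_le C, simp\<close>)
qed

lemma of_real_in_legendre_disc:
  assumes "\<bar>x\<bar> < 1"
  shows "ereal (norm (complex_of_real x)) < fps_conv_radius (legendre_fps \<nu>)"
    and "ereal (norm (complex_of_real x)) < fps_conv_radius (fps_deriv (legendre_fps \<nu>))"
    and "ereal (norm (complex_of_real x)) < fps_conv_radius (legendre_flux_fps \<nu>)"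
proof -
  have "ereal (norm (complex_of_real x)) < 1"
    using assms by simp
  then show "ereal (norm (complex_of_real x)) < fps_conv_radius (legendre_fps \<nu>)"
    using fps_conv_radius_legendre_fps by (rule less_le_trans)
  then show deriv: "ereal (norm (complex_of_real x)) < fps_conv_radius (fps_deriv (legendre_fps \<nu>))"
    using fps_conv_radius_deriv by (rule less_le_trans)
  have "fps_conv_radius (1 - fps_X :: complex fps) = \<infinity>"
    using fps_conv_radius_diff[of "1 :: complex fps" fps_X] by simp
  then have "fps_conv_radius (fps_X * (1 - fps_X) :: complex fps) = \<infinity>"
    using fps_conv_radius_mult[of "fps_X :: complex fps" "1 - fps_X"] by simp
  then have "fps_conv_radius (fps_deriv (legendre_fps \<nu>)) \<le> fps_conv_radius (legendre_flux_fps \<nu>)"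
    using fps_conv_radius_mult[of "fps_X * (1 - fps_X)" "fps_deriv (legendre_fps \<nu>)"] by simp
  with deriv show "ereal (norm (complex_of_real x)) < fps_conv_radius (legendre_flux_fps \<nu>)"
    by (rule less_le_trans)
qed

lemma legendre_fun_sums:
  "\<bar>x\<bar> < 1 \<Longrightarrow> (\<lambda>k. legendre_fun_coeff \<nu> k * of_real x ^ k) sums legendre_fun \<nu> x"
  using sums_eval_fps[OF of_real_in_legendre_disc(1)]
  by (simp add: legendre_fun_def hyp2F1_def legendre_fun_coeff_def)

lemma legendre_flux_fps_nth:
  "fps_nth (legendre_flux_fps \<nu>) 0 = 0"
  "fps_nth (legendre_flux_fps \<nu>) (Suc k) =
     of_nat (Suc k) * legendre_fun_coeff \<nu> (Suc k) - of_nat k * legendre_fun_coeff \<nu> k"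
  by (simp add: mult.assoc)
     (cases k; auto simp: mult.assoc left_diff_distrib legendre_fun_coeff_def)

lemma legendre_flux_fps_nth_Suc:
  "of_nat (Suc k) * fps_nth (legendre_flux_fps \<nu>) (Suc k) = - (\<nu> * (\<nu> + 1)) * legendre_fun_coeff \<nu> k"
  using legendre_fun_coeff_Suc[of k \<nu>]
  unfolding legendre_flux_fps_nth by (simp add: algebra_simps power2_eq_square)

lemma legendre_fps_ode:
  "fps_deriv (legendre_flux_fps \<nu>) = fps_const (- (\<nu> * (\<nu> + 1))) * legendre_fps \<nu>"
proof (rule fps_ext)
  fix n
  show "fps_nth (fps_deriv (legendre_flux_fps \<nu>)) n
      = fps_nth (fps_const (- (\<nu> * (\<nu> + 1))) * legendre_fps \<nu>) n"
    unfolding fps_deriv_nth Suc_eq_plus1[symmetric] legendre_flux_fps_nth_Suc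
    by (simp add: legendre_fun_coeff_def)
qed

lemma legendre_fun_flux_eq:
  assumes "\<bar>x\<bar> < 1"
  shows "legendre_fun_flux \<nu> x =
    of_real (x * (1 - x)) * eval_fps (fps_deriv (legendre_fps \<nu>)) (of_real x)"
  unfolding legendre_fun_flux_def using of_real_in_legendre_disc(2)[OF assms]
  by (simp add: eval_fps_mult eval_fps_diff less_le_trans[OF _ fps_conv_radius_mult]
      less_le_trans[OF _ fps_conv_radius_diff])

lemma legendre_fun_has_vector_derivative:
  assumes "\<bar>x\<bar> < 1"
  shows "(legendre_fun \<nu> has_vector_derivative
      eval_fps (fps_deriv (legendre_fps \<nu>)) (of_real x)) (at x)"
    and "(legendre_fun_flux \<nu> has_vector_derivative - (\<nu> * (\<nu> + 1)) * legendre_fun \<nu> x) (at x)"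
proof -
  note disc = of_real_in_legendre_disc[OF assms, of \<nu>]
  show "(legendre_fun \<nu> has_vector_derivative eval_fps (fps_deriv (legendre_fps \<nu>)) (of_real x)) (at x)"
    unfolding legendre_fun_def[abs_def] hyp2F1_def
    by (intro has_vector_derivative_real_field has_field_derivative_eval_fps disc)
  have "eval_fps (fps_deriv (legendre_flux_fps \<nu>)) (of_real x) = - (\<nu> * (\<nu> + 1)) * legendre_fun \<nu> x"
    unfolding legendre_fps_ode legendre_fun_def hyp2F1_def
    using disc(1) by (simp add: eval_fps_mult)
  then show "(legendre_fun_flux \<nu> has_vector_derivative - (\<nu> * (\<nu> + 1)) * legendre_fun \<nu> x) (at x)"
    unfolding legendre_fun_flux_def[abs_def]
    using has_field_derivative_eval_fps[OF disc(3), of UNIV]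
    by (intro has_vector_derivative_real_field) simp
qed

lemma legendre_system_legendre_fun:
  "legendre_system (\<nu> * (\<nu> + 1)) (legendre_fun \<nu>) (legendre_fun_flux \<nu>)"
  unfolding legendre_system_def
proof (intro ballI conjI)
  fix x :: real
  assume x: "x \<in> {0<..<1}"
  then have "legendre_fun_flux \<nu> x / of_real (x * (1 - x))
      = eval_fps (fps_deriv (legendre_fps \<nu>)) (of_real x)"
    by (simp add: legendre_fun_flux_eq)
  then show "(legendre_fun \<nu> has_vector_derivative
      legendre_fun_flux \<nu> x / of_real (x * (1 - x))) (at x)"
    using legendre_fun_has_vector_derivative(1)[of x \<nu>] x by simp
  show "(legendre_fun_flux \<nu> has_vector_derivative - (\<nu> * (\<nu> + 1)) * legendre_fun \<nu> x) (at x)"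
    using x by (intro legendre_fun_has_vector_derivative) auto
qed

lemma legendre_fun_bound:
  "\<exists>C>0. \<forall>\<nu> x. norm (\<nu> * (\<nu> + 1)) \<le> \<Lambda> \<longrightarrow> x \<in> {0..<1} \<longrightarrow>
     norm (legendre_fun \<nu> x) \<le> C / sqrt (1 - x)"
proof -
  obtain C where C [rule_format]: "C > 0"
    "\<forall>\<nu> k. norm (\<nu> * (\<nu> + 1)) \<le> \<Lambda> \<longrightarrow> norm (legendre_fun_coeff \<nu> k) \<le> C * central_binomial_ratio k"
    using legendre_fun_coeff_bound by blast
  have "norm (legendre_fun \<nu> x) \<le> C / sqrt (1 - x)"
    if \<nu>: "norm (\<nu> * (\<nu> + 1)) \<le> \<Lambda>" and x: "x \<in> {0..<1}" for \<nu> x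
  proof (rule norm_sums_le)
    show "(\<lambda>k. legendre_fun_coeff \<nu> k * of_real x ^ k) sums legendre_fun \<nu> x"
      using x by (intro legendre_fun_sums) auto
    show "(\<lambda>k. C * (central_binomial_ratio k * x ^ k)) sums (C / sqrt (1 - x))"
      using x sums_mult[OF central_binomial_ratio_power_series[of x], of C] by simp
    show "norm (legendre_fun_coeff \<nu> k * of_real x ^ k) \<le> C * (central_binomial_ratio k * x ^ k)" for k
      using x by (intro norm_mult_power_le C(2) \<nu>) simp
  qed
  with C(1) show ?thesis
    by blast
qed

lemma continuous_on_legendre_fun_flux: "continuous_on {0..1} (legendre_fun_flux \<nu>)"
proof -
  obtain C where C: "\<And>k. norm (legendre_fun_coeff \<nu> k) \<le> C * central_binomial_ratio k"
    using legendre_fun_coeff_bound[of "norm (\<nu> * (\<nu> + 1))"] by (meson order.refl)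
  have "norm (fps_nth (legendre_flux_fps \<nu>) (Suc k))
      \<le> norm (\<nu> * (\<nu> + 1)) * C * (central_binomial_ratio k / (real k + 1))" for k
  proof -
    have "(real k + 1) * norm (fps_nth (legendre_flux_fps \<nu>) (Suc k))
        = norm (\<nu> * (\<nu> + 1)) * norm (legendre_fun_coeff \<nu> k)"
      using arg_cong[OF legendre_flux_fps_nth_Suc[of k \<nu>], of norm]
      unfolding norm_mult norm_minus_cancel norm_of_nat by (simp add: add.commute)
    also have "\<dots> \<le> norm (\<nu> * (\<nu> + 1)) * (C * central_binomial_ratio k)"
      by (intro mult_left_mono C) auto
    finally show ?thesis
      by (simp add: pos_le_divide_eq mult_ac)
  qed
  then have "summable (\<lambda>k. norm (fps_nth (legendre_flux_fps \<nu>) (Suc k)))"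
    by (intro summable_comparison_test'[OF
          summable_mult[OF summable_central_binomial_ratio_over_Suc]]) auto
  then have "summable (\<lambda>k. norm (fps_nth (legendre_flux_fps \<nu>) k))"
    by (rule summable_Suc_iff[THEN iffD1])
  moreover have "norm (fps_nth (legendre_flux_fps \<nu>) k * of_real x ^ k)
      \<le> norm (fps_nth (legendre_flux_fps \<nu>) k)" if "x \<in> {0..1}" for k x
    using that by (simp add: norm_mult norm_power power_le_one mult_left_le)
  ultimately have "uniform_limit {0..1} (\<lambda>N x. \<Sum>k<N. fps_nth (legendre_flux_fps \<nu>) k * of_real x ^ k)
      (legendre_fun_flux \<nu>) sequentially"
    unfolding legendre_fun_flux_def[abs_def] eval_fps_def by (intro Weierstrass_m_test) auto
  then show ?thesis
    by (rule uniform_limit_theorem[rotated]) (auto intro!: always_eventually continuous_intros)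
qed

lemma legendre_fun_flux_1: "legendre_fun_flux \<nu> 1 = - sin (of_real pi * \<nu>) / of_real pi"
proof -
  have "(\<lambda>k. fps_nth (legendre_flux_fps \<nu>) (Suc k)) sums
      (- sin (of_real pi * \<nu>) / of_real pi - of_nat 0 * legendre_fun_coeff \<nu> 0)"
    unfolding legendre_flux_fps_nth by (rule telescope_sums[OF legendre_fun_coeff_limit])
  then have "fps_nth (legendre_flux_fps \<nu>) sums (- sin (of_real pi * \<nu>) / of_real pi)"
    by (subst (asm) sums_Suc_iff) simp
  then show ?thesis
    by (simp add: legendre_fun_flux_def eval_fps_def sums_iff)
qed

lemma tendsto_legendre_fun_at_right_0:
  "(legendre_fun \<nu> \<longlongrightarrow> 1) (at_right 0)"
  "(legendre_fun_flux \<nu> \<longlongrightarrow> 0) (at_right 0)"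
  "((\<lambda>x. legendre_fun_flux \<nu> (1 - x)) \<longlongrightarrow> - sin (of_real pi * \<nu>) / of_real pi) (at_right 0)"
proof -
  have "isCont (legendre_fun \<nu>) 0"
    by (rule has_vector_derivative_continuous[OF legendre_fun_has_vector_derivative(1)]) simp
  then show "(legendre_fun \<nu> \<longlongrightarrow> 1) (at_right 0)"
    by (auto simp: isCont_def intro: tendsto_within_subset)
  show "(legendre_fun_flux \<nu> \<longlongrightarrow> 0) (at_right 0)"
    using continuous_on_Icc_at_rightD[OF continuous_on_legendre_fun_flux, of \<nu>] by simp
  have "(legendre_fun_flux \<nu> \<longlongrightarrow> - sin (of_real pi * \<nu>) / of_real pi) (at_left 1)"
    using continuous_on_Icc_at_leftD[OF continuous_on_legendre_fun_flux, of \<nu>]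
    by (simp add: legendre_fun_flux_1)
  then show "((\<lambda>x. legendre_fun_flux \<nu> (1 - x)) \<longlongrightarrow> - sin (of_real pi * \<nu>) / of_real pi) (at_right 0)"
    unfolding tendsto_at_left_1_iff_reflect .
qed

lemma tendsto_x_times_legendre_fun_reflect:
  "((\<lambda>x. of_real x * legendre_fun \<nu> (1 - x)) \<longlongrightarrow> 0) (at_right 0)"
proof -
  obtain C where C: "\<And>x. x \<in> {0..<1} \<Longrightarrow> norm (legendre_fun \<nu> x) \<le> C / sqrt (1 - x)"
    using legendre_fun_bound[of "norm (\<nu> * (\<nu> + 1))"] by (meson order.refl)
  have "norm (of_real x * legendre_fun \<nu> (1 - x)) \<le> C * sqrt x" if "x \<in> {0<..<1}" for x
  proof -
    have "norm (of_real x * legendre_fun \<nu> (1 - x)) \<le> x * (C / sqrt x)"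
      unfolding norm_mult using that C[of "1 - x"] by (intro mult_mono) auto
    also have "\<dots> = C * sqrt x"
      using that by (simp add: field_simps)
    finally show ?thesis .
  qed
  then have "\<forall>\<^sub>F x in at_right 0. norm (of_real x * legendre_fun \<nu> (1 - x)) \<le> C * sqrt x"
    by (rule eventually_mono[OF eventually_at_right_real[OF zero_less_one]])
  moreover have "((\<lambda>x. C * sqrt x) \<longlongrightarrow> 0) (at_right 0)"
    by (rule tendsto_eq_intros | simp)+
  ultimately show ?thesis
    by (rule Lim_null_comparison)
qed

lemma tendsto_legendre_fun_flux_times_reflect:
  "((\<lambda>x. legendre_fun_flux \<mu> x * legendre_fun \<nu> (1 - x)) \<longlongrightarrow> 0) (at_right 0)"
proof -
  let ?F' = "\<lambda>x. eval_fps (fps_deriv (legendre_fps \<mu>)) (complex_of_real x)"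
  have "isCont ?F' 0"
    using has_field_derivative_eval_fps[OF of_real_in_legendre_disc(2)[of 0 \<mu>], of UNIV]
    by (intro has_vector_derivative_continuous[OF has_vector_derivative_real_field]) auto
  then have "(?F' \<longlongrightarrow> ?F' 0) (at_right 0)"
    by (auto simp: isCont_def intro: tendsto_within_subset)
  then have "((\<lambda>x. of_real (1 - x) * ?F' x * (of_real x * legendre_fun \<nu> (1 - x)))
      \<longlongrightarrow> of_real (1 - 0) * ?F' 0 * 0) (at_right 0)"
    by (intro tendsto_intros tendsto_x_times_legendre_fun_reflect)
  moreover have "\<forall>\<^sub>F x in at_right 0. of_real (1 - x) * ?F' x * (of_real x * legendre_fun \<nu> (1 - x))
      = legendre_fun_flux \<mu> x * legendre_fun \<nu> (1 - x)"
    using eventually_at_right_real[OF zero_less_one]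
    by eventually_elim (simp add: legendre_fun_flux_eq mult_ac)
  ultimately show ?thesis
    by (auto intro: Lim_transform_eventually)
qed

lemma legendre_fun_tendsto:
  assumes X: "X \<longlonglongrightarrow> \<nu>" and \<Lambda>: "\<And>j. norm (X j * (X j + 1)) \<le> \<Lambda>" and x: "x \<in> {0<..<1}"
  shows "(\<lambda>j. legendre_fun (X j) x) \<longlonglongrightarrow> legendre_fun \<nu> x"
proof -
  obtain C where C [rule_format]: "C > 0"
    "\<forall>\<nu> k. norm (\<nu> * (\<nu> + 1)) \<le> \<Lambda> \<longrightarrow> norm (legendre_fun_coeff \<nu> k) \<le> C * central_binomial_ratio k"
    using legendre_fun_coeff_bound by blast
  have majorant: "summable (\<lambda>k. C * (central_binomial_ratio k * x ^ k))"
    using x by (intro summable_central_binomial_ratio_power) auto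
  have "norm (legendre_fun_coeff (X j) k * of_real x ^ k)
      \<le> C * (central_binomial_ratio k * x ^ k)" for j k
    using x by (intro norm_mult_power_le C(2) \<Lambda>) simp
  then have bound: "\<forall>\<^sub>F (k, j) in at_top \<times>\<^sub>F sequentially.
      norm (legendre_fun_coeff (X j) k * of_real x ^ k) \<le> C * (central_binomial_ratio k * x ^ k)"
    by (intro always_eventually) auto
  have "(\<lambda>j. legendre_fun_coeff (X j) k * of_real x ^ k)
      \<longlonglongrightarrow> legendre_fun_coeff \<nu> k * of_real x ^ k" for k
    unfolding legendre_fun_coeff_pochhammer pochhammer_prod by (intro tendsto_intros X) simp
  then have "(\<lambda>j. \<Sum>k. legendre_fun_coeff (X j) k * of_real x ^ k)
      \<longlonglongrightarrow> (\<Sum>k. legendre_fun_coeff \<nu> k * of_real x ^ k)"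
    by (rule tannerys_theorem[OF _ bound majorant, THEN conjunct2, THEN conjunct2]) simp
  then show ?thesis
    by (simp add: legendre_fun_eq_suminf)
qed

section \<open>Legendre moments of the product\<close>

definition legendre_product :: "complex \<Rightarrow> complex \<Rightarrow> real \<Rightarrow> complex" where
  "legendre_product \<mu> \<nu> x = legendre_fun \<mu> x * legendre_fun \<nu> (1 - x)"

definition legendre_moment :: "complex \<Rightarrow> complex \<Rightarrow> nat \<Rightarrow> complex" where
  "legendre_moment \<mu> \<nu> n = integral {0<..<1} (\<lambda>x. legendre_product \<mu> \<nu> x * shifted_legendre n x)"

lemma continuous_on_legendre_product: "continuous_on {0<..<1} (legendre_product \<mu> \<nu>)"
  unfolding legendre_product_def[abs_def]
  using legendre_system_continuous_on[OF legendre_system_legendre_fun]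
    legendre_system_continuous_on[OF legendre_system_reflect[OF legendre_system_legendre_fun]]
  by (intro continuous_on_mult)

lemma legendre_product_bound:
  "\<exists>C. \<forall>\<mu> \<nu> x. norm (\<mu> * (\<mu> + 1)) \<le> \<Lambda> \<longrightarrow> norm (\<nu> * (\<nu> + 1)) \<le> \<Lambda> \<longrightarrow> x \<in> {0<..<1} \<longrightarrow>
     norm (legendre_product \<mu> \<nu> x) \<le> C * arcsine_weight x"
proof -
  obtain C where C [rule_format]: "C > 0"
    "\<forall>\<nu> x. norm (\<nu> * (\<nu> + 1)) \<le> \<Lambda> \<longrightarrow> x \<in> {0..<1} \<longrightarrow> norm (legendre_fun \<nu> x) \<le> C / sqrt (1 - x)"
    using legendre_fun_bound by blast
  have "norm (legendre_product \<mu> \<nu> x) \<le> C * C * arcsine_weight x"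
    if "norm (\<mu> * (\<mu> + 1)) \<le> \<Lambda>" "norm (\<nu> * (\<nu> + 1)) \<le> \<Lambda>" "x \<in> {0<..<1}" for \<mu> \<nu> x
  proof -
    have "norm (legendre_product \<mu> \<nu> x) \<le> C / sqrt (1 - x) * (C / sqrt x)"
      unfolding legendre_product_def norm_mult
      using that C(1) C(2)[of \<mu> x] C(2)[of \<nu> "1 - x"] by (intro mult_mono) auto
    then show ?thesis
      by (simp add: arcsine_weight_def real_sqrt_mult mult_ac)
  qed
  then show ?thesis
    by (intro exI[of _ "C * C"] allI impI)
qed

lemma arcsine_dominated_legendre_product: "arcsine_dominated (legendre_product \<mu> \<nu>)"
proof -
  define \<Lambda> where "\<Lambda> = max (norm (\<mu> * (\<mu> + 1))) (norm (\<nu> * (\<nu> + 1)))"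
  have "norm (\<mu> * (\<mu> + 1)) \<le> \<Lambda>" "norm (\<nu> * (\<nu> + 1)) \<le> \<Lambda>"
    by (simp_all add: \<Lambda>_def)
  then obtain C where "\<And>x. x \<in> {0<..<1} \<Longrightarrow> norm (legendre_product \<mu> \<nu> x) \<le> C * arcsine_weight x"
    using legendre_product_bound[of \<Lambda>] by blast
  then show ?thesis
    by (rule arcsine_dominatedI[OF continuous_on_legendre_product])
qed

lemma has_integral_legendre_moment:
  "((\<lambda>x. legendre_product \<mu> \<nu> x * shifted_legendre n x) has_integral legendre_moment \<mu> \<nu> n) {0<..<1}"
  unfolding legendre_moment_def
  by (intro integrable_integral arcsine_dominated_absolutely_integrable
        arcsine_dominated_mult_continuous arcsine_dominated_legendre_product continuous_intros)

lemma legendre_eigenvalue_bounded: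
  fixes \<nu> :: complex
  assumes "X \<longlonglongrightarrow> \<nu>"
  shows "\<exists>K. \<forall>j. norm (X j * (X j + 1)) \<le> K"
proof -
  have "(\<lambda>j. X j * (X j + 1)) \<longlonglongrightarrow> \<nu> * (\<nu> + 1)"
    by (intro tendsto_intros assms)
  then have "Bseq (\<lambda>j. X j * (X j + 1))"
    by (intro convergent_imp_Bseq convergentI)
  then show ?thesis
    by (auto simp: Bseq_def)
qed

lemma legendre_moment_tendsto:
  assumes X: "X \<longlonglongrightarrow> \<mu>" and Y: "Y \<longlonglongrightarrow> \<nu>"
  shows "(\<lambda>j. legendre_moment (X j) (Y j) n) \<longlonglongrightarrow> legendre_moment \<mu> \<nu> n"
proof -
  obtain K L where "\<And>j. norm (X j * (X j + 1)) \<le> K" "\<And>j. norm (Y j * (Y j + 1)) \<le> L"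
    using legendre_eigenvalue_bounded[OF X] legendre_eigenvalue_bounded[OF Y] by blast
  then have \<Lambda>: "norm (X j * (X j + 1)) \<le> max K L" "norm (Y j * (Y j + 1)) \<le> max K L" for j
    by (simp_all add: le_max_iff_disj)
  obtain C where C: "\<And>j x. x \<in> {0<..<1} \<Longrightarrow> norm (legendre_product (X j) (Y j) x) \<le> C * arcsine_weight x"
    using legendre_product_bound[of "max K L"] \<Lambda> by blast
  obtain A where A: "A > 0" "\<And>x. x \<in> {0..1} \<Longrightarrow> norm (shifted_legendre n x) \<le> A"
    using shifted_legendre_bounded by blast
  show ?thesis
    unfolding legendre_moment_def
  proof (rule arcsine_dominated_convergence)
    show "continuous_on {0<..<1} (\<lambda>x. legendre_product (X j) (Y j) x * shifted_legendre n x)" for j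
      by (intro continuous_intros continuous_on_legendre_product)
    fix x :: real
    assume x: "x \<in> {0<..<1}"
    show "norm (legendre_product (X j) (Y j) x * shifted_legendre n x) \<le> C * A * arcsine_weight x" for j
    proof -
      have "norm (legendre_product (X j) (Y j) x * shifted_legendre n x) \<le> C * arcsine_weight x * A"
        unfolding norm_mult
        using A(1) A(2)[of x] C[OF x, of j] order.trans[OF norm_ge_zero C[OF x]] x
        by (intro mult_mono) auto
      then show ?thesis
        by (simp add: mult_ac)
    qed
    show "(\<lambda>j. legendre_product (X j) (Y j) x * shifted_legendre n x)
        \<longlonglongrightarrow> legendre_product \<mu> \<nu> x * shifted_legendre n x"
      unfolding legendre_product_def using x
      by (intro tendsto_intros legendre_fun_tendsto[OF X \<Lambda>(1)] legendre_fun_tendsto[OF Y \<Lambda>(2)]) auto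
  qed
qed

lemma legendre_moment_isCont:
  "isCont (\<lambda>\<nu>. legendre_moment \<mu> \<nu> n) \<nu>" "isCont (\<lambda>\<nu>. legendre_moment \<nu> \<nu> n) \<nu>"
  unfolding continuous_at_sequentially
  by (auto simp: o_def intro!: legendre_moment_tendsto)

lemma legendre_moment_odd: "legendre_moment \<nu> \<nu> (2 * m + 1) = 0"
proof -
  let ?f = "\<lambda>x. legendre_product \<nu> \<nu> x * shifted_legendre (2 * m + 1) x"
  have "?f (1 - x) = - ?f x" for x
    unfolding shifted_legendre_reflect by (simp add: legendre_product_def)
  then have "((\<lambda>x. - ?f x) has_integral legendre_moment \<nu> \<nu> (2 * m + 1)) {0<..<1}"
    using has_integral_reflect_unit_interval[OF
        has_integral_legendre_moment[of \<nu> \<nu> "2 * m + 1"]] by simp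
  moreover have "((\<lambda>x. - ?f x) has_integral - legendre_moment \<nu> \<nu> (2 * m + 1)) {0<..<1}"
    by (intro has_integral_neg has_integral_legendre_moment)
  ultimately have "legendre_moment \<nu> \<nu> (2 * m + 1) = - legendre_moment \<nu> \<nu> (2 * m + 1)"
    by (rule has_integral_unique)
  then show ?thesis
    by simp
qed

lemma legendre_moment_0_green:
  "(\<nu> * (\<nu> + 1) - \<mu> * (\<mu> + 1)) * legendre_moment \<mu> \<nu> 0 =
     (sin (of_real pi * \<nu>) - sin (of_real pi * \<mu>)) / of_real pi"
proof -
  let ?s = "\<lambda>\<sigma>. sin (of_real pi * \<sigma>) / complex_of_real pi"
  have "((\<lambda>x. (\<nu> * (\<nu> + 1) - \<mu> * (\<mu> + 1)) * (legendre_fun \<mu> x * legendre_fun \<nu> (1 - x)))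
      has_integral (- ?s \<mu> - (- ?s \<nu>))) {0<..<1}"
  proof (rule legendre_system_green[OF legendre_system_legendre_fun
        legendre_system_reflect[OF legendre_system_legendre_fun]])
    let ?F = legendre_fun and ?G = legendre_fun_flux
    note limits = tendsto_legendre_fun_at_right_0 tendsto_legendre_fun_flux_times_reflect
    have "((\<lambda>x. ?G \<mu> x * ?F \<nu> (1 - x) + ?F \<mu> x * ?G \<nu> (1 - x)) \<longlongrightarrow> 0 + 1 * (- ?s \<nu>)) (at_right 0)"
      using limits by (intro tendsto_add tendsto_mult) auto
    then show "((\<lambda>x. ?G \<mu> x * ?F \<nu> (1 - x) - ?F \<mu> x * - ?G \<nu> (1 - x)) \<longlongrightarrow> - ?s \<nu>) (at_right 0)"
      by simp
    have "((\<lambda>x. ?G \<mu> (1 - x) * ?F \<nu> x + ?G \<nu> x * ?F \<mu> (1 - x)) \<longlongrightarrow> - ?s \<mu> * 1 + 0) (at_right 0)"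
      using limits by (intro tendsto_add tendsto_mult) auto
    then show "((\<lambda>x. ?G \<mu> x * ?F \<nu> (1 - x) - ?F \<mu> x * - ?G \<nu> (1 - x)) \<longlongrightarrow> - ?s \<mu>) (at_left 1)"
      unfolding tendsto_at_left_1_iff_reflect by (simp add: mult.commute)
  qed
  moreover have "((\<lambda>x. (\<nu> * (\<nu> + 1) - \<mu> * (\<mu> + 1)) * (legendre_fun \<mu> x * legendre_fun \<nu> (1 - x)))
      has_integral (\<nu> * (\<nu> + 1) - \<mu> * (\<mu> + 1)) * legendre_moment \<mu> \<nu> 0) {0<..<1}"
    using has_integral_legendre_moment[of \<mu> \<nu> 0]
    by (intro has_integral_mult_right) (simp add: legendre_product_def)
  ultimately have "(\<nu> * (\<nu> + 1) - \<mu> * (\<mu> + 1)) * legendre_moment \<mu> \<nu> 0 = - ?s \<mu> - (- ?s \<nu>)"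
    by (rule has_integral_unique[rotated])
  then show ?thesis
    by (simp add: diff_divide_distrib)
qed

lemma legendre_moment_0: "(2 * \<mu> + 1) * legendre_moment \<mu> \<mu> 0 = cos (of_real pi * \<mu>)"
proof -
  let ?s = "\<lambda>\<sigma>. sin (of_real pi * \<sigma>) / complex_of_real pi"
  have moment: "((\<lambda>\<nu>. (\<nu> + \<mu> + 1) * legendre_moment \<mu> \<nu> 0)
      \<longlongrightarrow> (\<mu> + \<mu> + 1) * legendre_moment \<mu> \<mu> 0) (at \<mu>)"
    using legendre_moment_isCont(1) unfolding isCont_def by (intro tendsto_mult tendsto_intros)
  have "(?s has_field_derivative cos (of_real pi * \<mu>)) (at \<mu>)"
    by (auto intro!: derivative_eq_intros)
  then have derivative: "((\<lambda>\<nu>. (?s \<nu> - ?s \<mu>) / (\<nu> - \<mu>)) \<longlongrightarrow> cos (of_real pi * \<mu>)) (at \<mu>)"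
    by (simp add: has_field_derivative_iff)
  have "\<forall>\<^sub>F \<nu> in at \<mu>. (?s \<nu> - ?s \<mu>) / (\<nu> - \<mu>) = (\<nu> + \<mu> + 1) * legendre_moment \<mu> \<nu> 0"
    using eventually_neq_at_within[of \<mu> \<mu> UNIV]
  proof eventually_elim
    case (elim \<nu>)
    have "(\<nu> - \<mu>) * ((\<nu> + \<mu> + 1) * legendre_moment \<mu> \<nu> 0)
        = (\<nu> * (\<nu> + 1) - \<mu> * (\<mu> + 1)) * legendre_moment \<mu> \<nu> 0"
      by (simp add: algebra_simps)
    also have "\<dots> = ?s \<nu> - ?s \<mu>"
      unfolding legendre_moment_0_green by (rule diff_divide_distrib)
    finally show ?case
      using elim by (simp add: divide_eq_eq mult.commute)
  qed
  then have "(\<mu> + \<mu> + 1) * legendre_moment \<mu> \<mu> 0 = cos (of_real pi * \<mu>)"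
    by (rule tendsto_unique[OF trivial_limit_at moment Lim_transform_eventually[OF derivative]])
  then show ?thesis
    by (simp only: mult_2)
qed

lemma legendre_product_symmetric_square:
  fixes \<nu> :: complex and n :: nat
  defines "l \<equiv> \<nu> * (\<nu> + 1)" and "k \<equiv> complex_of_nat n * (of_nat n + 1)"
  shows "((\<lambda>x. legendre_product \<nu> \<nu> x *
      ((2 * l - k) * ((1 - 2 * of_real x) * shifted_legendre n x + shifted_legendre_flux n x)
        + 2 * l * shifted_legendre_flux n x)) has_integral 0) {0<..<1}"
  unfolding legendre_product_def l_def k_def
proof (rule legendre_system_symmetric_square[OF legendre_system_legendre_fun
      legendre_system_reflect[OF legendre_system_legendre_fun] legendre_system_shifted_legendre])
  let ?F = "legendre_fun \<nu>" and ?G = "legendre_fun_flux \<nu>"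
    and ?y = "shifted_legendre n" and ?Y = "shifted_legendre_flux n"
  define c where "c = 2 * (\<nu> * (\<nu> + 1)) - of_nat n * (of_nat n + 1)"
  define B where "B x = 2 * (?G x * - ?G (1 - x)) * ?y x
      + c * (of_real (x * (1 - x)) * (?F x * ?F (1 - x))) * ?y x
      - (?F x * - ?G (1 - x) + ?G x * ?F (1 - x)) * ?Y x" for x
  note limits = tendsto_legendre_fun_at_right_0[of \<nu>] tendsto_legendre_fun_flux_times_reflect[of \<nu> \<nu>]
  have "((\<lambda>x. of_real (1 - x) * ?F x * (of_real x * ?F (1 - x)))
      \<longlongrightarrow> of_real (1 - 0) * 1 * 0) (at_right 0)"
    by (intro tendsto_intros limits tendsto_x_times_legendre_fun_reflect)
  then have product: "((\<lambda>x. of_real (x * (1 - x)) * (?F x * ?F (1 - x))) \<longlongrightarrow> 0) (at_right 0)"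
    by (simp add: mult_ac)
  show "(B \<longlongrightarrow> 0) (at_right 0)"
    unfolding B_def by (rule tendsto_eq_intros limits product refl | simp)+
  have "B (1 - x) = 2 * (?G x * - ?G (1 - x)) * ?y (1 - x)
      + c * (of_real (x * (1 - x)) * (?F x * ?F (1 - x))) * ?y (1 - x)
      - (?F x * ?G (1 - x) - ?G x * ?F (1 - x)) * ?Y (1 - x)" for x
    by (simp add: B_def algebra_simps)
  then show "(B \<longlongrightarrow> 0) (at_left 1)"
    unfolding tendsto_at_left_1_iff_reflect
    by (simp only:) (rule tendsto_eq_intros limits product refl | simp)+
qed

lemma legendre_moment_recurrence:
  "(of_nat n + 2)\<^sup>2 * ((of_nat n + 1) * (of_nat n + 3) - 4 * (\<nu> * (\<nu> + 1)))
      * legendre_moment \<nu> \<nu> (Suc (Suc n))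
   = (of_nat n + 1)\<^sup>2 * (of_nat n * (of_nat n + 2) - 4 * (\<nu> * (\<nu> + 1))) * legendre_moment \<nu> \<nu> n"
proof -
  define l where "l = \<nu> * (\<nu> + 1)"
  define N :: complex where "N = of_nat n"
  define a where "a = (N + 2)\<^sup>2 * ((N + 1) * (N + 3) - 4 * l)"
  define b where "b = (N + 1)\<^sup>2 * (N * (N + 2) - 4 * l)"
  let ?y = "shifted_legendre (Suc n)" and ?Y = "shifted_legendre_flux (Suc n)"
  have combination: "2 * (2 * N + 3) * ((2 * l - of_nat (Suc n) * (of_nat (Suc n) + 1))
      * ((1 - 2 * of_real x) * ?y x + ?Y x) + 2 * l * ?Y x)
      = a * shifted_legendre (Suc (Suc n)) x - b * shifted_legendre n x" for x
    using shifted_legendre_recurrence[of n x] shifted_legendre_flux_Suc[of n x]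
    unfolding a_def b_def N_def[symmetric] of_nat_Suc by algebra
  have "2 * (2 * N + 3) * (w * ((2 * l - of_nat (Suc n) * (of_nat (Suc n) + 1))
      * ((1 - 2 * of_real x) * ?y x + ?Y x) + 2 * l * ?Y x))
      = a * (w * shifted_legendre (Suc (Suc n)) x) - b * (w * shifted_legendre n x)" for w x
    unfolding mult.left_commute[of "2 * (2 * N + 3)" w] combination by (simp add: algebra_simps)
  then have "((\<lambda>x. a * (legendre_product \<nu> \<nu> x * shifted_legendre (Suc (Suc n)) x)
      - b * (legendre_product \<nu> \<nu> x * shifted_legendre n x)) has_integral 2 * (2 * N + 3) * 0) {0<..<1}"
    using has_integral_mult_right[OF legendre_product_symmetric_square[of \<nu> "Suc n", folded l_def],
        of "2 * (2 * N + 3)"] by simp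
  moreover have "((\<lambda>x. a * (legendre_product \<nu> \<nu> x * shifted_legendre (Suc (Suc n)) x)
      - b * (legendre_product \<nu> \<nu> x * shifted_legendre n x)) has_integral
      (a * legendre_moment \<nu> \<nu> (Suc (Suc n)) - b * legendre_moment \<nu> \<nu> n)) {0<..<1}"
    by (intro has_integral_diff has_integral_mult_right has_integral_legendre_moment)
  ultimately have
    "a * legendre_moment \<nu> \<nu> (Suc (Suc n)) - b * legendre_moment \<nu> \<nu> n = 2 * (2 * N + 3) * 0"
    by (rule has_integral_unique[rotated])
  then show ?thesis
    by (simp add: a_def b_def l_def N_def)
qed

section \<open>The expansion coefficients\<close>

text \<open>By the reflection formula, the factor \<open>sin (\<pi> \<nu>)\<close> cancels the poles of the two Gamma factors
  in the numerator; this is the resulting entire function of \<open>\<nu>\<close>.\<close>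

definition expansion_coeff_entire :: "complex \<Rightarrow> nat \<Rightarrow> complex" where
  "expansion_coeff_entire \<nu> m =
     of_real pi / 2 * of_nat (4 * m + 1) * (of_real (central_binomial_ratio m))\<^sup>2 *
     (pochhammer (- \<nu>) m * pochhammer (\<nu> + 1) m) *
     (rGamma (of_nat m - \<nu> + 1 / 2) * rGamma (of_nat m + \<nu> + 3 / 2))"

lemma expansion_coeff_entire_isCont: "isCont (\<lambda>\<nu>. expansion_coeff_entire \<nu> m) \<nu>"
  unfolding expansion_coeff_entire_def pochhammer_prod by (intro continuous_intros)

lemma Gamma_mult_pochhammer:
  assumes "z \<notin> \<int>\<^sub>\<le>\<^sub>0"
  shows "Gamma (z + of_nat m) = Gamma z * pochhammer z m"
  using pochhammer_Gamma[OF assms, of m] assms by (simp add: Gamma_eq_zero_iff)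

lemma expansion_coeff_formula_eq_entire:
  assumes "\<nu> \<notin> \<int>"
  shows "expansion_coeff_formula \<nu> m = expansion_coeff_entire \<nu> m"
proof -
  have poles: "- \<nu> \<notin> \<int>\<^sub>\<le>\<^sub>0" "\<nu> + 1 \<notin> \<int>\<^sub>\<le>\<^sub>0"
    using assms nonpos_Ints_Int[of "- \<nu>"] nonpos_Ints_Int[of "\<nu> + 1"]
      Ints_minus[of "- \<nu>"] Ints_diff[of "\<nu> + 1" 1] by auto
  have "sin (of_real pi * \<nu>) \<noteq> 0"
    using assms by (auto simp: sin_eq_0 Ints_def)
  then have reflection: "- (sin (of_real pi * \<nu>) / 2) * (Gamma (- \<nu>) * Gamma (\<nu> + 1)) = of_real pi / 2"
    using Gamma_reflection_complex[of "- \<nu>"] by (simp add: add.commute)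
  have "Gamma (of_nat m - \<nu>) * Gamma (of_nat m + \<nu> + 1)
      = Gamma (- \<nu>) * Gamma (\<nu> + 1) * (pochhammer (- \<nu>) m * pochhammer (\<nu> + 1) m)"
    using Gamma_mult_pochhammer[OF poles(1), of m] Gamma_mult_pochhammer[OF poles(2), of m]
    by (simp add: add_ac)
  moreover have "1 / 4 ^ m * complex_of_nat ((2 * m) choose m) = of_real (central_binomial_ratio m)"
    by (simp add: central_binomial_ratio_def)
  ultimately have "expansion_coeff_formula \<nu> m =
      (- (sin (of_real pi * \<nu>) / 2) * (Gamma (- \<nu>) * Gamma (\<nu> + 1))) *
      (of_nat (4 * m + 1) * (of_real (central_binomial_ratio m))\<^sup>2 *
       (pochhammer (- \<nu>) m * pochhammer (\<nu> + 1) m) *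
       (rGamma (of_nat m - \<nu> + 1 / 2) * rGamma (of_nat m + \<nu> + 3 / 2)))"
    unfolding expansion_coeff_formula_def rGamma_inverse_Gamma
    by (simp only: divide_inverse inverse_mult_distrib mult_ac)
  then show ?thesis
    unfolding reflection expansion_coeff_entire_def by (simp only: mult_ac)
qed

lemma eventually_double_not_Ints: "\<forall>\<^sub>F \<mu> in at \<nu>. 2 * \<mu> \<notin> (\<int> :: complex set)"
proof -
  have "((\<lambda>\<mu>. 2 * \<mu>) \<longlongrightarrow> 2 * \<nu>) (at \<nu>)"
    by (intro tendsto_intros)
  moreover have "open (- (\<int> - {2 * \<nu>}))"
    using closed_subset_Ints[of "\<int> - {2 * \<nu>}"] by (intro open_Compl) auto
  ultimately have "\<forall>\<^sub>F \<mu> in at \<nu>. 2 * \<mu> \<in> - (\<int> - {2 * \<nu>})"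
    by (rule topological_tendstoD) simp
  then show ?thesis
    using eventually_neq_at_within[of \<nu> \<nu> UNIV] by eventually_elim auto
qed

lemma not_Ints_if_double_not_Ints: "2 * \<nu> \<notin> \<int> \<Longrightarrow> \<nu> \<notin> (\<int> :: complex set)"
  by (metis Ints_mult Ints_numeral)

lemma expansion_coeff_eq_entire: "expansion_coeff \<nu> m = expansion_coeff_entire \<nu> m"
proof -
  have "((\<lambda>\<mu>. expansion_coeff_entire \<mu> m) \<longlongrightarrow> expansion_coeff_entire \<nu> m) (at \<nu>)"
    using expansion_coeff_entire_isCont by (simp add: isCont_def)
  moreover have "\<forall>\<^sub>F \<mu> in at \<nu>. expansion_coeff_entire \<mu> m = expansion_coeff_formula \<mu> m"
    using eventually_double_not_Ints
    by eventually_elim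
      (rule expansion_coeff_formula_eq_entire[OF not_Ints_if_double_not_Ints, symmetric])
  ultimately have lim: "((\<lambda>\<mu>. expansion_coeff_formula \<mu> m) \<longlongrightarrow> expansion_coeff_entire \<nu> m) (at \<nu>)"
    by (rule Lim_transform_eventually)
  show ?thesis
  proof (cases "of_nat m - \<nu> \<in> \<int>\<^sub>\<le>\<^sub>0 \<or> of_nat m + \<nu> + 1 \<in> \<int>\<^sub>\<le>\<^sub>0")
    case True
    then show ?thesis
      using tendsto_Lim[OF _ lim] by (simp add: expansion_coeff_def)
  next
    case False
    then have "isCont (\<lambda>\<mu>. expansion_coeff_formula \<mu> m) \<nu>"
      unfolding expansion_coeff_formula_def divide_inverse inverse_mult_distrib
        rGamma_inverse_Gamma[symmetric]
      by (intro continuous_intros) auto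
    then have "((\<lambda>\<mu>. expansion_coeff_formula \<mu> m) \<longlongrightarrow> expansion_coeff_formula \<nu> m) (at \<nu>)"
      by (simp only: isCont_def)
    with False show ?thesis
      using tendsto_unique[OF trivial_limit_at _ lim] by (simp add: expansion_coeff_def)
  qed
qed

lemma expansion_coeff_entire_0: "(2 * \<nu> + 1) * expansion_coeff_entire \<nu> 0 = cos (of_real pi * \<nu>)"
proof -
  have "of_real pi * (\<nu> + 1 / 2) = of_real pi * \<nu> + of_real (pi / 2)"
    by (simp add: algebra_simps)
  then have "sin (of_real pi * (\<nu> + 1 / 2)) = cos (of_real pi * \<nu>)"
    by (simp only: sin_add sin_of_real cos_of_real) simp
  then have "rGamma (\<nu> + 1 / 2) * rGamma (- \<nu> + 1 / 2) = cos (of_real pi * \<nu>) / of_real pi"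
    using rGamma_reflection_complex[of "\<nu> + 1 / 2"] by simp
  moreover have "(\<nu> + 1 / 2) * rGamma (\<nu> + 3 / 2) = rGamma (\<nu> + 1 / 2)"
    using rGamma_plus1[of "\<nu> + 1 / 2"] by (simp add: add.assoc)
  moreover have "(2 * \<nu> + 1) * expansion_coeff_entire \<nu> 0
      = of_real pi * ((\<nu> + 1 / 2) * rGamma (\<nu> + 3 / 2) * rGamma (- \<nu> + 1 / 2))"
    by (simp add: expansion_coeff_entire_def field_simps)
  ultimately show ?thesis
    by simp
qed

lemma expansion_coeff_entire_Suc:
  "of_nat (4 * m + 1) * ((of_nat m + 1)\<^sup>2 * ((of_nat m - \<nu> + 1 / 2) * (of_nat m + \<nu> + 3 / 2))
      * expansion_coeff_entire \<nu> (Suc m))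
   = of_nat (4 * m + 5) * ((of_nat m + 1 / 2)\<^sup>2 * ((of_nat m - \<nu>) * (of_nat m + \<nu> + 1))
      * expansion_coeff_entire \<nu> m)"
proof -
  define r s where "r = rGamma (of_nat (Suc m) - \<nu> + 1 / 2)"
    and "s = rGamma (of_nat (Suc m) + \<nu> + 3 / 2)"
  have r: "rGamma (of_nat m - \<nu> + 1 / 2) = (of_nat m - \<nu> + 1 / 2) * r"
    using rGamma_plus1[of "of_nat m - \<nu> + 1 / 2"] by (simp add: r_def algebra_simps)
  have s: "rGamma (of_nat m + \<nu> + 3 / 2) = (of_nat m + \<nu> + 3 / 2) * s"
    using rGamma_plus1[of "of_nat m + \<nu> + 3 / 2"] by (simp add: s_def algebra_simps)
  have "(real m + 1) * central_binomial_ratio (Suc m) = (real m + 1 / 2) * central_binomial_ratio m"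
    unfolding central_binomial_ratio_Suc by (simp add: field_simps)
  from arg_cong[OF this, of "\<lambda>c. (complex_of_real c)\<^sup>2"]
  have ratio: "(of_nat m + 1)\<^sup>2 * (complex_of_real (central_binomial_ratio (Suc m)))\<^sup>2
      = (of_nat m + 1 / 2)\<^sup>2 * (of_real (central_binomial_ratio m))\<^sup>2"
    by (simp add: power_mult_distrib)
  have pochhammers: "pochhammer (- \<nu>) (Suc m) * pochhammer (\<nu> + 1) (Suc m)
      = (of_nat m - \<nu>) * (of_nat m + \<nu> + 1) * (pochhammer (- \<nu>) m * pochhammer (\<nu> + 1) m)"
    by (simp add: pochhammer_Suc algebra_simps)
  have index: "4 * Suc m + 1 = 4 * m + 5"
    by simp
  define K where "K = of_nat (4 * m + 1) * of_nat (4 * m + 5) * (of_real pi / 2) *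
      ((of_nat m - \<nu> + 1 / 2) * (of_nat m + \<nu> + 3 / 2)) * ((of_nat m - \<nu>) * (of_nat m + \<nu> + 1)) *
      (pochhammer (- \<nu>) m * pochhammer (\<nu> + 1) m) * (r * s)"
  have "of_nat (4 * m + 1) * ((of_nat m + 1)\<^sup>2 * ((of_nat m - \<nu> + 1 / 2) * (of_nat m + \<nu> + 3 / 2))
      * expansion_coeff_entire \<nu> (Suc m))
      = (of_nat m + 1)\<^sup>2 * (complex_of_real (central_binomial_ratio (Suc m)))\<^sup>2 * K"
    unfolding expansion_coeff_entire_def pochhammers index r_def[symmetric] s_def[symmetric] K_def
    by (simp only: mult_ac)
  also have "\<dots> = of_nat (4 * m + 5) * ((of_nat m + 1 / 2)\<^sup>2 * ((of_nat m - \<nu>) * (of_nat m + \<nu> + 1))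
      * expansion_coeff_entire \<nu> m)"
    unfolding ratio expansion_coeff_entire_def r s K_def by (simp only: mult_ac)
  finally show ?thesis .
qed

lemma legendre_moment_even_recurrence:
  "(of_nat m + 1)\<^sup>2 * ((of_nat m - \<nu> + 1 / 2) * (of_nat m + \<nu> + 3 / 2))
      * legendre_moment \<nu> \<nu> (2 * Suc m)
   = (of_nat m + 1 / 2)\<^sup>2 * ((of_nat m - \<nu>) * (of_nat m + \<nu> + 1)) * legendre_moment \<nu> \<nu> (2 * m)"
  (is "?c * _ = ?d * _")
proof -
  define N :: complex where "N = of_nat m"
  have "(2 * N + 2)\<^sup>2 * ((2 * N + 1) * (2 * N + 3) - 4 * (\<nu> * (\<nu> + 1))) = 16 * ?c"
    "(2 * N + 1)\<^sup>2 * (2 * N * (2 * N + 2) - 4 * (\<nu> * (\<nu> + 1))) = 16 * ?d"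
    unfolding N_def[symmetric] by (simp_all add: field_simps power2_eq_square)
  then have "16 * ?c * legendre_moment \<nu> \<nu> (2 * Suc m) = 16 * ?d * legendre_moment \<nu> \<nu> (2 * m)"
    using legendre_moment_recurrence[of "2 * m" \<nu>] by (simp add: N_def)
  then show ?thesis
    by (simp add: mult.assoc)
qed

lemma half_integer_shift_neq_0:
  fixes \<nu> :: complex
  assumes \<nu>: "2 * \<nu> \<notin> \<int>"
  shows "of_nat m - \<nu> + 1 / 2 \<noteq> 0" "of_nat m + \<nu> + 3 / 2 \<noteq> 0"
proof -
  show "of_nat m - \<nu> + 1 / 2 \<noteq> 0"
  proof
    assume "of_nat m - \<nu> + 1 / 2 = 0"
    then have "2 * \<nu> = of_nat (2 * m + 1)"
      by (simp add: field_simps)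
    with \<nu> show False
      by (metis Ints_of_nat)
  qed
  show "of_nat m + \<nu> + 3 / 2 \<noteq> 0"
  proof
    assume "of_nat m + \<nu> + 3 / 2 = 0"
    then have "2 * \<nu> = - of_nat (2 * m + 3)"
      by (simp add: field_simps eq_neg_iff_add_eq_0)
    with \<nu> show False
      by (metis Ints_minus Ints_of_nat)
  qed
qed

lemma legendre_moment_eq_expansion_coeff_generic:
  assumes \<nu>: "2 * \<nu> \<notin> \<int>"
  shows "of_nat (4 * m + 1) * legendre_moment \<nu> \<nu> (2 * m) = expansion_coeff_entire \<nu> m"
proof (induction m)
  case 0
  have "2 * \<nu> + 1 \<noteq> 0"
    using \<nu> by (metis Ints_1 Ints_minus add_eq_0_iff2)
  moreover have "(2 * \<nu> + 1) * legendre_moment \<nu> \<nu> 0 = (2 * \<nu> + 1) * expansion_coeff_entire \<nu> 0"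
    unfolding legendre_moment_0 expansion_coeff_entire_0 ..
  ultimately show ?case
    by simp
next
  case (Suc m)
  define N :: complex where "N = of_nat m"
  define c where "c = (N + 1)\<^sup>2 * ((N - \<nu> + 1 / 2) * (N + \<nu> + 3 / 2))"
  define d where "d = (N + 1 / 2)\<^sup>2 * ((N - \<nu>) * (N + \<nu> + 1))"
  have "N + 1 \<noteq> 0" "4 * N + 1 \<noteq> 0"
    using of_nat_neq_0[of m, where 'a = complex]
      double_of_nat_plus_1_neq_0[of "2 * m", where 'a = complex]
    by (simp_all add: N_def add.commute)
  then have nonzero: "(4 * N + 1) * c \<noteq> 0"
    using half_integer_shift_neq_0[OF \<nu>, of m] by (simp add: c_def N_def)
  have "c * legendre_moment \<nu> \<nu> (2 * Suc m) = d * legendre_moment \<nu> \<nu> (2 * m)"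
    unfolding c_def d_def N_def by (rule legendre_moment_even_recurrence)
  moreover have "(4 * N + 1) * (c * expansion_coeff_entire \<nu> (Suc m))
      = (4 * N + 5) * (d * expansion_coeff_entire \<nu> m)"
    using expansion_coeff_entire_Suc[of m \<nu>] by (simp add: c_def d_def N_def add.commute)
  moreover have "(4 * N + 1) * legendre_moment \<nu> \<nu> (2 * m) = expansion_coeff_entire \<nu> m"
    using Suc.IH by (simp add: N_def add.commute)
  ultimately have "(4 * N + 1) * c * ((4 * N + 5) * legendre_moment \<nu> \<nu> (2 * Suc m))
      = (4 * N + 1) * c * expansion_coeff_entire \<nu> (Suc m)"
    by algebra
  then have "(4 * N + 5) * legendre_moment \<nu> \<nu> (2 * Suc m) = expansion_coeff_entire \<nu> (Suc m)"
    using nonzero by (simp only: mult_cancel_left simp_thms)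
  then show ?case
    by (simp add: N_def add.commute)
qed

lemma legendre_moment_eq_expansion_coeff:
  "of_nat (4 * m + 1) * legendre_moment \<nu> \<nu> (2 * m) = expansion_coeff \<nu> m"
proof -
  have "((\<lambda>\<mu>. of_nat (4 * m + 1) * legendre_moment \<mu> \<mu> (2 * m))
      \<longlongrightarrow> of_nat (4 * m + 1) * legendre_moment \<nu> \<nu> (2 * m)) (at \<nu>)"
    using legendre_moment_isCont(2) unfolding isCont_def by (intro tendsto_mult tendsto_const)
  moreover have "\<forall>\<^sub>F \<mu> in at \<nu>.
      of_nat (4 * m + 1) * legendre_moment \<mu> \<mu> (2 * m) = expansion_coeff_entire \<mu> m"
    using eventually_double_not_Ints
    by eventually_elim (rule legendre_moment_eq_expansion_coeff_generic)
  ultimately have "((\<lambda>\<mu>. expansion_coeff_entire \<mu> m)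
      \<longlongrightarrow> of_nat (4 * m + 1) * legendre_moment \<nu> \<nu> (2 * m)) (at \<nu>)"
    by (rule Lim_transform_eventually)
  with expansion_coeff_entire_isCont[where m = m and \<nu> = \<nu>] show ?thesis
    unfolding isCont_def expansion_coeff_eq_entire
    by (rule tendsto_unique[OF trivial_limit_at, rotated])
qed

lemma tendsto_add_of_nat_over_of_nat:
  fixes z :: "'a::real_normed_field"
  shows "(\<lambda>m. (z + of_nat m) / of_nat m) \<longlonglongrightarrow> 1"
proof (rule Lim_transform_eventually)
  show "(\<lambda>m. z * inverse (of_nat m) + 1) \<longlonglongrightarrow> 1"
    by (rule tendsto_eq_intros lim_inverse_n refl | simp)+
  show "\<forall>\<^sub>F m in sequentially. z * inverse (of_nat m) + 1 = (z + of_nat m) / of_nat m"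
    using eventually_gt_at_top[of 0] by eventually_elim (simp add: field_simps)
qed

lemma rGamma_add_of_nat_asymp_no_pole:
  fixes z :: complex
  assumes z: "z \<notin> \<int>\<^sub>\<le>\<^sub>0"
  shows "(\<lambda>m. fact m * of_nat m powr (z - 1) * rGamma (z + of_nat m)) \<longlonglongrightarrow> 1"
proof (rule Lim_transform_eventually)
  have "(\<lambda>m. rGamma z * ((z + of_nat m) / of_nat m) / rGamma_series z m) \<longlonglongrightarrow> rGamma z * 1 / rGamma z"
    using z by (intro tendsto_divide tendsto_mult tendsto_const tendsto_add_of_nat_over_of_nat
        rGamma_series_LIMSEQ) (simp add: rGamma_eq_zero_iff)
  then show "(\<lambda>m. rGamma z * ((z + of_nat m) / of_nat m) / rGamma_series z m) \<longlonglongrightarrow> 1"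
    using z by (simp add: rGamma_eq_zero_iff)
  show "\<forall>\<^sub>F m in sequentially. rGamma z * ((z + of_nat m) / of_nat m) / rGamma_series z m
      = fact m * of_nat m powr (z - 1) * rGamma (z + of_nat m)"
    using eventually_gt_at_top[of 0]
  proof eventually_elim
    case (elim m)
    have "z + of_nat m \<noteq> 0" "pochhammer z m \<noteq> 0"
      using z by (auto simp: add_eq_0_iff2 pochhammer_eq_0_iff)
    moreover have power: "complex_of_nat m powr (z - 1) = exp (z * of_real (ln (real m))) / of_nat m"
      using elim by (simp add: powr_def left_diff_distrib exp_diff exp_of_real)
    ultimately show ?case
      unfolding power rGamma_series_def pochhammer_rGamma[of z m]
      using elim by (simp add: pochhammer_Suc divide_simps)
  qed
qed

lemma rGamma_add_of_nat_asymp_shift: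
  fixes z :: complex
  assumes "(\<lambda>m. fact m * of_nat m powr z * rGamma (z + 1 + of_nat m)) \<longlonglongrightarrow> 1"
  shows "(\<lambda>m. fact m * of_nat m powr (z - 1) * rGamma (z + of_nat m)) \<longlonglongrightarrow> 1"
proof (rule Lim_transform_eventually)
  show "(\<lambda>m. fact m * of_nat m powr z * rGamma (z + 1 + of_nat m) * ((z + of_nat m) / of_nat m)) \<longlonglongrightarrow> 1"
    using tendsto_mult[OF assms tendsto_add_of_nat_over_of_nat[of z]] by simp
  show "\<forall>\<^sub>F m in sequentially.
      fact m * of_nat m powr z * rGamma (z + 1 + of_nat m) * ((z + of_nat m) / of_nat m)
      = fact m * of_nat m powr (z - 1) * rGamma (z + of_nat m)"
    using eventually_gt_at_top[of 0]
  proof eventually_elim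
    case (elim m)
    have "complex_of_nat m powr z = of_nat m powr (z - 1) * of_nat m"
      using elim powr_add[of "complex_of_nat m" "z - 1" 1] by simp
    moreover have "(z + of_nat m) * rGamma (z + 1 + of_nat m) = rGamma (z + of_nat m)"
      using rGamma_plus1[of "z + of_nat m"] by (simp add: add_ac)
    ultimately show ?case
      using elim by (simp add: field_simps)
  qed
qed

lemma rGamma_add_of_nat_asymp:
  fixes z :: complex
  shows "(\<lambda>m. fact m * of_nat m powr (z - 1) * rGamma (z + of_nat m)) \<longlonglongrightarrow> 1"
proof (cases "z \<in> \<int>\<^sub>\<le>\<^sub>0")
  case True
  have "(\<lambda>m. fact m * of_nat m powr (- of_nat n - 1) * rGamma (- of_nat n + complex_of_nat m))
      \<longlonglongrightarrow> 1" for n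
  proof (induction n)
    case 0
    show ?case
      using rGamma_add_of_nat_asymp_shift[of 0] rGamma_add_of_nat_asymp_no_pole[of 1] by simp
  next
    case (Suc n)
    then show ?case
      using rGamma_add_of_nat_asymp_shift[of "- of_nat (Suc n)"] by (simp add: minus_diff_commute)
  qed
  with True show ?thesis
    by (auto elim!: nonpos_Ints_cases')
qed (rule rGamma_add_of_nat_asymp_no_pole)

lemma fact_square_mult_rGammas_limit:
  fixes \<nu> :: complex
  shows "(\<lambda>m. (fact m)\<^sup>2 * (rGamma (of_nat m - \<nu> + 1 / 2) * rGamma (of_nat m + \<nu> + 3 / 2))) \<longlonglongrightarrow> 1"
proof (rule Lim_transform_eventually)
  let ?R = "\<lambda>z m. fact m * of_nat m powr (z - 1) * rGamma (z + of_nat m)"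
  show "(\<lambda>m. ?R (1 / 2 - \<nu>) m * ?R (\<nu> + 3 / 2) m) \<longlonglongrightarrow> 1"
    using tendsto_mult[OF rGamma_add_of_nat_asymp[of "1 / 2 - \<nu>"]
        rGamma_add_of_nat_asymp[of "\<nu> + 3 / 2"]]
    by (simp only: mult_1)
  show "\<forall>\<^sub>F m in sequentially. ?R (1 / 2 - \<nu>) m * ?R (\<nu> + 3 / 2) m
      = (fact m)\<^sup>2 * (rGamma (of_nat m - \<nu> + 1 / 2) * rGamma (of_nat m + \<nu> + 3 / 2))"
    using eventually_gt_at_top[of 0]
  proof eventually_elim
    case (elim m)
    have "complex_of_nat m powr (1 / 2 - \<nu> - 1) * of_nat m powr (\<nu> + 3 / 2 - 1) = 1"
      using elim by (simp flip: powr_add)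
    moreover have "?R (1 / 2 - \<nu>) m * ?R (\<nu> + 3 / 2) m
        = (fact m)\<^sup>2 * (of_nat m powr (1 / 2 - \<nu> - 1) * of_nat m powr (\<nu> + 3 / 2 - 1)) *
          (rGamma (1 / 2 - \<nu> + of_nat m) * rGamma (\<nu> + 3 / 2 + of_nat m))"
      by (simp only: power2_eq_square mult_ac)
    moreover have "1 / 2 - \<nu> + of_nat m = of_nat m - \<nu> + 1 / 2"
      "\<nu> + 3 / 2 + of_nat m = of_nat m + \<nu> + 3 / 2"
      by simp_all
    ultimately show ?case
      by (simp only: mult_1_right)
  qed
qed

lemma expansion_coeff_limit:
  "(\<lambda>m. of_nat m * expansion_coeff \<nu> m) \<longlonglongrightarrow> - 2 * sin (of_real pi * \<nu>) / of_real pi"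
proof (rule Lim_transform_eventually)
  let ?G = "\<lambda>m. rGamma (of_nat m - \<nu> + 1 / 2) * rGamma (of_nat m + \<nu> + 3 / 2)"
  let ?f = "\<lambda>m. of_real pi / 2 * (4 + inverse (of_nat m)) *
      (of_nat m * legendre_fun_coeff (- 1 / 2) m) * (of_nat m * legendre_fun_coeff \<nu> m) *
      ((fact m)\<^sup>2 * ?G m)"
  have "?f \<longlonglongrightarrow> of_real pi / 2 * (4 + 0) * (- sin (of_real pi * (- 1 / 2)) / of_real pi) *
      (- sin (of_real pi * \<nu>) / of_real pi) * 1"
    by (intro tendsto_mult tendsto_add tendsto_const lim_inverse_n
          legendre_fun_coeff_limit fact_square_mult_rGammas_limit)
  moreover have "sin (complex_of_real pi * (- 1 / 2)) = - 1"
    using sin_of_real[of "pi / 2", where 'a = complex] by simp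
  ultimately show "?f \<longlonglongrightarrow> - 2 * sin (of_real pi * \<nu>) / of_real pi"
    by simp
  show "\<forall>\<^sub>F m in sequentially. ?f m = of_nat m * expansion_coeff \<nu> m"
    using eventually_gt_at_top[of 0]
  proof eventually_elim
    case (elim m)
    have index: "of_nat m * (4 + inverse (of_nat m)) = (of_nat (4 * m + 1) :: complex)"
      using elim by (simp add: field_simps)
    have coeff: "legendre_fun_coeff \<nu> m * (fact m)\<^sup>2 = pochhammer (- \<nu>) m * pochhammer (\<nu> + 1) m"
      by (simp add: legendre_fun_coeff_pochhammer)
    show ?case
      unfolding expansion_coeff_eq_entire expansion_coeff_entire_def legendre_fun_coeff_minus_half
        index[symmetric] coeff[symmetric]
      by (simp only: mult_ac)
  qed
qed

lemma expansion_coeff_Int_eventually_0: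
  assumes "\<nu> \<in> \<int>"
  obtains M where "\<And>m. m \<ge> M \<Longrightarrow> expansion_coeff \<nu> m = 0"
proof -
  obtain M where M: "\<And>m. m \<ge> M \<Longrightarrow> legendre_fun_coeff \<nu> m = 0"
    using legendre_fun_coeff_Int_eventually_0[OF assms] by blast
  have "expansion_coeff \<nu> m = 0" if "m \<ge> M" for m
    using M[OF that]
    by (auto simp: legendre_fun_coeff_pochhammer expansion_coeff_eq_entire expansion_coeff_entire_def)
  then show ?thesis
    using that by blast
qed

section \<open>The expansion\<close>

lemma sums_single_double:
  "(\<lambda>m. if 2 * m = n then f m else 0) sums (if even n then f (n div 2) else 0)"
proof (cases "even n")
  case True
  then have "(\<lambda>m. if 2 * m = n then f m else 0) = (\<lambda>m. if m = n div 2 then f m else 0)"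
    by auto
  with True show ?thesis
    using sums_single[of "n div 2" f] by simp
next
  case False
  then have "2 * m \<noteq> n" for m
    by auto
  with False show ?thesis
    by simp
qed

context
  fixes a :: "nat \<Rightarrow> complex" and C :: real
  assumes decay: "\<And>m. norm (a m) \<le> C / (real m + 1)"
begin

lemma even_legendre_series_bound:
  assumes "x \<in> {0<..<1}"
  shows "norm (a m * shifted_legendre (2 * m) x)
    \<le> C / 2 * (central_binomial_ratio m / (real m + 1)) * arcsine_weight x"
proof -
  have "norm (a m * shifted_legendre (2 * m) x)
      \<le> C / (real m + 1) * (central_binomial_ratio m / 2 * arcsine_weight x)"
    unfolding norm_mult using decay[of m] order.trans[OF norm_ge_zero decay[of m]]
    by (intro mult_mono norm_shifted_legendre_even_le assms) auto
  then show ?thesis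
    by (simp add: mult_ac)
qed

lemma summable_even_legendre_majorant:
  "summable (\<lambda>m. C / 2 * (central_binomial_ratio m / (real m + 1)))"
  by (intro summable_mult summable_central_binomial_ratio_over_Suc)

lemma summable_even_legendre_series:
  "x \<in> {0<..<1} \<Longrightarrow> summable (\<lambda>m. a m * shifted_legendre (2 * m) x)"
  by (rule arcsine_dominated_summable[OF _ even_legendre_series_bound summable_even_legendre_majorant])
     (intro continuous_intros)

lemma arcsine_dominated_even_legendre_series:
  "arcsine_dominated (\<lambda>x. \<Sum>m. a m * shifted_legendre (2 * m) x)"
  by (rule arcsine_dominated_suminf[OF _ even_legendre_series_bound summable_even_legendre_majorant])
     (intro continuous_intros)

lemma even_legendre_series_moment:
  "((\<lambda>x. (\<Sum>m. a m * shifted_legendre (2 * m) x) * shifted_legendre n x) has_integral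
     (if even n then a (n div 2) / (2 * of_nat n + 1) else 0)) {0<..<1}"
proof -
  obtain A where A: "A > 0" "\<And>x. x \<in> {0..1} \<Longrightarrow> norm (shifted_legendre n x) \<le> A"
    using shifted_legendre_bounded by blast
  have "((\<lambda>x. \<Sum>m. a m * shifted_legendre (2 * m) x * shifted_legendre n x) has_integral
      (if even n then a (n div 2) / (2 * of_nat n + 1) else 0)) {0<..<1}"
  proof (rule arcsine_dominated_suminf_has_integral)
    show "continuous_on {0<..<1} (\<lambda>x. a m * shifted_legendre (2 * m) x * shifted_legendre n x)" for m
      by (intro continuous_intros)
    show "norm (a m * shifted_legendre (2 * m) x * shifted_legendre n x)
        \<le> A * (C / 2 * (central_binomial_ratio m / (real m + 1))) * arcsine_weight x"
      if x: "x \<in> {0<..<1}" for m x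
    proof -
      have "norm (a m * shifted_legendre (2 * m) x * shifted_legendre n x)
          \<le> C / 2 * (central_binomial_ratio m / (real m + 1)) * arcsine_weight x * A"
        unfolding norm_mult[of _ "shifted_legendre n x"]
        using x A(2)[of x] order.trans[OF norm_ge_zero even_legendre_series_bound[OF x]]
        by (intro mult_mono even_legendre_series_bound) auto
      then show ?thesis
        by (simp only: mult_ac)
    qed
    show "summable (\<lambda>m. A * (C / 2 * (central_binomial_ratio m / (real m + 1))))"
      by (intro summable_mult summable_even_legendre_majorant)
    show "((\<lambda>x. a m * shifted_legendre (2 * m) x * shifted_legendre n x) has_integral
        (if 2 * m = n then a m / (2 * of_nat n + 1) else 0)) {0<..<1}" for m
      using has_integral_mult_right[OF shifted_legendre_inner_product[of "2 * m" n], of "a m"]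
      by (auto simp: mult.assoc split: if_splits)
  qed (rule sums_single_double)
  moreover have "(\<Sum>m. a m * shifted_legendre (2 * m) x * shifted_legendre n x)
      = (\<Sum>m. a m * shifted_legendre (2 * m) x) * shifted_legendre n x" if "x \<in> {0<..<1}" for x
    by (rule suminf_mult2[OF summable_even_legendre_series[OF that], symmetric])
  ultimately show ?thesis
    by (rule has_integral_eq[rotated])
qed

end

lemma expansion_coeff_over_eq_legendre_moment:
  "(if even n then expansion_coeff \<nu> (n div 2) / (2 * of_nat n + 1) else 0) = legendre_moment \<nu> \<nu> n"
proof (cases "even n")
  case True
  then obtain m where n: "n = 2 * m"
    by blast
  have "expansion_coeff \<nu> m = legendre_moment \<nu> \<nu> n * (2 * of_nat n + 1)"
    using legendre_moment_eq_expansion_coeff[of m \<nu>] by (simp add: n add.commute mult.commute)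
  then show ?thesis
    using True double_of_nat_plus_1_neq_0[of n, where 'a = complex] by (simp add: n divide_eq_eq)
next
  case False
  then show ?thesis
    using legendre_moment_odd by (auto elim!: oddE)
qed

lemma expansion_sums_interior:
  assumes x: "x \<in> {0<..<1}"
  shows "(\<lambda>m. expansion_coeff \<nu> m * shifted_legendre (2 * m) x) sums legendre_product \<nu> \<nu> x"
proof -
  obtain C where C: "\<And>m. norm (expansion_coeff \<nu> m) \<le> C / (real m + 1)"
    using norm_le_over_Suc_if_convergent[OF expansion_coeff_limit] by blast
  define S where "S x = (\<Sum>m. expansion_coeff \<nu> m * shifted_legendre (2 * m) x)" for x
  have moment: "((\<lambda>x. S x * shifted_legendre n x) has_integral legendre_moment \<nu> \<nu> n) {0<..<1}" for n
    using even_legendre_series_moment[OF C, of n]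
    unfolding S_def expansion_coeff_over_eq_legendre_moment .
  have "legendre_product \<nu> \<nu> x - S x = 0"
  proof (rule arcsine_dominated_eq_0_if_orthogonal_legendre[OF _ _ x])
    show "arcsine_dominated (\<lambda>x. legendre_product \<nu> \<nu> x - S x)"
      unfolding S_def
      by (intro arcsine_dominated_diff arcsine_dominated_legendre_product
            arcsine_dominated_even_legendre_series[OF C])
    show "((\<lambda>x. (legendre_product \<nu> \<nu> x - S x) * shifted_legendre n x) has_integral 0) {0<..<1}" for n
      using has_integral_diff[OF has_integral_legendre_moment[of \<nu> \<nu> n] moment[of n]]
      by (simp add: left_diff_distrib)
  qed
  then show ?thesis
    using summable_sums[OF summable_even_legendre_series[OF C x]] by (simp add: S_def)
qed

lemma expansion_sums_Ints:
  assumes \<nu>: "\<nu> \<in> \<int>" and x: "x \<in> {0..1}"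
  shows "(\<lambda>m. expansion_coeff \<nu> m * shifted_legendre (2 * m) x) sums legendre_product \<nu> \<nu> x"
proof -
  obtain K where K: "\<And>k. k \<ge> K \<Longrightarrow> legendre_fun_coeff \<nu> k = 0"
    using legendre_fun_coeff_Int_eventually_0[OF \<nu>] by blast
  obtain M where M: "\<And>m. m \<ge> M \<Longrightarrow> expansion_coeff \<nu> m = 0"
    using expansion_coeff_Int_eventually_0[OF \<nu>] by blast
  have finite_series: "legendre_fun \<nu> y = (\<Sum>k<K. legendre_fun_coeff \<nu> k * of_real y ^ k)" for y
    unfolding legendre_fun_eq_suminf by (rule suminf_finite) (use K in auto)
  define s where "s y = (\<Sum>m<M. expansion_coeff \<nu> m * shifted_legendre (2 * m) y)" for y
  have sums: "(\<lambda>m. expansion_coeff \<nu> m * shifted_legendre (2 * m) y) sums s y" for y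
    unfolding s_def by (rule sums_finite) (use M in auto)
  have "closed {y. s y = legendre_product \<nu> \<nu> y}"
    unfolding s_def legendre_product_def finite_series by (intro closed_Collect_eq continuous_intros)
  moreover have "{0<..<1} \<subseteq> {y. s y = legendre_product \<nu> \<nu> y}"
    using sums_unique2[OF sums expansion_sums_interior] by auto
  ultimately have "closure {0<..<1} \<subseteq> {y. s y = legendre_product \<nu> \<nu> y}"
    by (rule closure_minimal[rotated])
  with x sums[of x] show ?thesis
    by auto
qed

lemma filterlim_sum_inverse_at_top: "filterlim (\<lambda>N. \<Sum>k<N. inverse (real k)) at_top sequentially"
proof -
  have "(\<Sum>k<Suc N. inverse (real k)) = harm N" for N
    by (induction N) (auto simp: harm_Suc harm_expand)
  then have "filterlim (\<lambda>N. \<Sum>k<Suc N. inverse (real k)) at_top sequentially"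
    using harm_at_top by simp
  then show ?thesis
    by (rule filterlim_sequentially_Suc[THEN iffD1])
qed

lemma filterlim_sum_at_infinity_of_harmonic_decay:
  fixes a :: "nat \<Rightarrow> 'a::real_inner"
  assumes lim: "(\<lambda>k. real k *\<^sub>R a k) \<longlonglongrightarrow> c" and "c \<noteq> 0"
  shows "filterlim (\<lambda>N. \<Sum>k<N. a k) at_infinity sequentially"
proof -
  define e where "e = (c \<bullet> c) / 2"
  have "e > 0" "e < c \<bullet> c"
    using \<open>c \<noteq> 0\<close> by (simp_all add: e_def)
  have "(\<lambda>k. (real k *\<^sub>R a k) \<bullet> c) \<longlonglongrightarrow> c \<bullet> c"
    by (intro tendsto_inner lim tendsto_const)
  from order_tendstoD(1)[OF this \<open>e < c \<bullet> c\<close>]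
  obtain K where K: "\<And>k. k \<ge> K \<Longrightarrow> e < real k * (a k \<bullet> c)"
    by (auto simp: eventually_sequentially)
  have above: "e * inverse (real k) \<le> a k \<bullet> c" if "k \<ge> K" for k
    using K[OF that] \<open>e > 0\<close> by (cases "k = 0") (auto simp: field_simps)
  define D where "D = (\<Sum>k<K. a k \<bullet> c - e * inverse (real k))"
  have lower: "D + e * (\<Sum>k<N. inverse (real k)) \<le> norm c * norm (\<Sum>k<N. a k)" if "N \<ge> K" for N
  proof -
    have "D \<le> (\<Sum>k<N. a k \<bullet> c - e * inverse (real k))"
      unfolding D_def using that by (intro sum_mono2) (auto intro: above)
    also have "\<dots> = (\<Sum>k<N. a k) \<bullet> c - e * (\<Sum>k<N. inverse (real k))"
      by (simp add: sum_subtractf sum_distrib_left inner_sum_left)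
    also have "(\<Sum>k<N. a k) \<bullet> c \<le> norm c * norm (\<Sum>k<N. a k)"
      by (metis norm_cauchy_schwarz mult.commute)
    finally show ?thesis
      by simp
  qed
  have "filterlim (\<lambda>N. D + e * (\<Sum>k<N. inverse (real k))) at_top sequentially"
    using \<open>e > 0\<close>
    by (intro filterlim_tendsto_add_at_top[OF tendsto_const]
          filterlim_tendsto_pos_mult_at_top[OF tendsto_const] filterlim_sum_inverse_at_top)
  then have "filterlim (\<lambda>N. norm c * norm (\<Sum>k<N. a k)) at_top sequentially"
    by (rule filterlim_at_top_mono) (auto simp: eventually_sequentially intro!: exI[of _ K] lower)
  then have "filterlim (\<lambda>N. norm (\<Sum>k<N. a k)) at_top sequentially"
    using \<open>c \<noteq> 0\<close> by (subst (asm) filterlim_tendsto_pos_mult_at_top_iff[OF tendsto_const]) auto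
  then show ?thesis
    by (rule filterlim_norm_at_top_imp_at_infinity)
qed

lemma sin_pi_eq_0_iff_Ints: "sin (complex_of_real pi * \<nu>) = 0 \<longleftrightarrow> \<nu> \<in> \<int>"
  by (auto simp: sin_eq_0 Ints_def)

lemma hyp2F1_partial_0: "N > 0 \<Longrightarrow> hyp2F1_partial a b c N 0 = 1"
  unfolding hyp2F1_partial_def
  by (cases N) (simp_all add: sum.lessThan_Suc_shift hyp2F1_fps_def del: sum.lessThan_Suc)

lemma hyp2F1_partial_product_at_infinity:
  assumes x: "x \<in> {0, 1}" and \<nu>: "\<nu> \<notin> \<int>"
  shows "filterlim (\<lambda>N. hyp2F1_partial (- \<nu>) (\<nu> + 1) 1 N (of_real x)
    * hyp2F1_partial (- \<nu>) (\<nu> + 1) 1 N (of_real (1 - x))) at_infinity sequentially"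
proof -
  have "filterlim (\<lambda>N. \<Sum>k<N. legendre_fun_coeff \<nu> k) at_infinity sequentially"
    using legendre_fun_coeff_limit[of \<nu>] \<nu>
    by (intro filterlim_sum_at_infinity_of_harmonic_decay)
       (auto simp: scaleR_conv_of_real sin_pi_eq_0_iff_Ints)
  moreover have "\<forall>\<^sub>F N in sequentially. hyp2F1_partial (- \<nu>) (\<nu> + 1) 1 N (of_real x)
      * hyp2F1_partial (- \<nu>) (\<nu> + 1) 1 N (of_real (1 - x)) = (\<Sum>k<N. legendre_fun_coeff \<nu> k)"
    using eventually_gt_at_top[of 0]
  proof eventually_elim
    case (elim N)
    have "hyp2F1_partial (- \<nu>) (\<nu> + 1) 1 N 1 = (\<Sum>k<N. legendre_fun_coeff \<nu> k)"
      by (simp add: hyp2F1_partial_def legendre_fun_coeff_def)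
    with x hyp2F1_partial_0[OF elim] show ?case
      by auto
  qed
  ultimately show ?thesis
    using filterlim_cong[OF refl refl] by fast
qed

lemma expansion_partial_sums_at_infinity:
  assumes x: "x \<in> {0, 1}" and \<nu>: "\<nu> \<notin> \<int>"
  shows "filterlim (\<lambda>N. \<Sum>m<N. expansion_coeff \<nu> m * shifted_legendre (2 * m) x)
    at_infinity sequentially"
proof -
  have "shifted_legendre (2 * m) x = 1" for m
    using x by (auto simp: shifted_legendre_def)
  then show ?thesis
    using expansion_coeff_limit[of \<nu>] \<nu>
    by (intro filterlim_sum_at_infinity_of_harmonic_decay)
       (auto simp: scaleR_conv_of_real sin_pi_eq_0_iff_Ints)
qed

lemma hyp2F1_product_eq_legendre_product: "hyp2F1_product \<nu> = legendre_product \<nu> \<nu>"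
  by (simp add: fun_eq_iff hyp2F1_product_def legendre_product_def legendre_fun_def)

lemma fourier_legendre_coeff_hyp2F1_product:
  "fourier_legendre_coeff (hyp2F1_product \<nu>) n = of_nat (2 * n + 1) * legendre_moment \<nu> \<nu> n"
  unfolding fourier_legendre_coeff_def hyp2F1_product_eq_legendre_product legendre_moment_def
  by (simp add: shifted_legendre_def integral_open_interval_real)

theorem theorem2p1:
  fixes \<nu> :: complex and x :: real
  assumes "x \<in> {0..1}"
  shows "(x \<in> {0<..<1} \<or> \<nu> \<in> \<int> \<longrightarrow>
            (\<lambda>m. expansion_coeff \<nu> m * of_real (legendre_P (2 * m) (2 * x - 1)))
              sums hyp2F1_product \<nu> x)
       \<and> (x \<in> {0, 1} \<and> \<nu> \<notin> \<int> \<longrightarrow>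
            filterlim (\<lambda>N. hyp2F1_partial (- \<nu>) (\<nu> + 1) 1 N (of_real x)
                         * hyp2F1_partial (- \<nu>) (\<nu> + 1) 1 N (of_real (1 - x)))
              at_infinity sequentially
          \<and> filterlim (\<lambda>N. \<Sum>m<N. expansion_coeff \<nu> m * of_real (legendre_P (2 * m) (2 * x - 1)))
              at_infinity sequentially)
       \<and> hyp2F1_product \<nu> absolutely_integrable_on {0..1}
       \<and> (\<forall>m. fourier_legendre_coeff (hyp2F1_product \<nu>) (2 * m) = expansion_coeff \<nu> m)
       \<and> (\<forall>m. fourier_legendre_coeff (hyp2F1_product \<nu>) (2 * m + 1) = 0)"
  unfolding shifted_legendre_def[symmetric]
proof (intro conjI impI allI)
  assume "x \<in> {0<..<1} \<or> \<nu> \<in> \<int>"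
  then show "(\<lambda>m. expansion_coeff \<nu> m * shifted_legendre (2 * m) x) sums hyp2F1_product \<nu> x"
    unfolding hyp2F1_product_eq_legendre_product
    using expansion_sums_interior expansion_sums_Ints[OF _ assms] by blast
next
  assume "x \<in> {0, 1} \<and> \<nu> \<notin> \<int>"
  then show "filterlim (\<lambda>N. hyp2F1_partial (- \<nu>) (\<nu> + 1) 1 N (of_real x)
      * hyp2F1_partial (- \<nu>) (\<nu> + 1) 1 N (of_real (1 - x))) at_infinity sequentially"
    by (intro hyp2F1_partial_product_at_infinity) auto
next
  assume "x \<in> {0, 1} \<and> \<nu> \<notin> \<int>"
  then show "filterlim (\<lambda>N. \<Sum>m<N. expansion_coeff \<nu> m * shifted_legendre (2 * m) x)
      at_infinity sequentially"
    by (intro expansion_partial_sums_at_infinity) auto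
next
  show "hyp2F1_product \<nu> absolutely_integrable_on {0..1}"
    unfolding hyp2F1_product_eq_legendre_product absolutely_integrable_on_Icc_iff_Ioo
    by (intro arcsine_dominated_absolutely_integrable arcsine_dominated_legendre_product)
next
  show "fourier_legendre_coeff (hyp2F1_product \<nu>) (2 * m) = expansion_coeff \<nu> m" for m
    using legendre_moment_eq_expansion_coeff by (simp add: fourier_legendre_coeff_hyp2F1_product)
  show "fourier_legendre_coeff (hyp2F1_product \<nu>) (2 * m + 1) = 0" for m
    by (simp only: fourier_legendre_coeff_hyp2F1_product legendre_moment_odd mult_zero_right)
qed

end
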